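(* Let $d\in\mathbb{N}$, let $O\subset\mathbb{R}^d$ be a non-empty open set, and let $\delta,\omega\in\mathrm{Meas}^+_{\mathrm{cmp}}(O)$. If $\omega$ is a $\mathrm{sbh}(O)$-balayage of $\delta$ and $E\subset\mathbb{R}^d$ is a polar set, then $$\omega\bigl((O\cap E)\setminus\operatorname{supp}\delta\bigr)=0.$$
   Context: $\mathrm{Meas}^+_{\mathrm{cmp}}(O)$ is the set of positive Borel (Radon) measures on $O$ with compact support in $O$. $\mathrm{sbh}(O)$ is the class of subharmonic functions on $O$ (values in $\mathbb{R}\cup\{-\infty\}$; identically $-\infty$ on a component allowed). $\mathrm{sbh}_*(\mathbb{R}^d)$ is the set of subharmonic functions on $\mathbb{R}^d$ that are not identically $-\infty$. For $d=1$ subharmonic means convex. The measure $\omega$ is a $\mathrm{sbh}(O)$-balayage of $\delta$ (written $\delta\preceq_{\mathrm{sbh}(O)}\omega$) if $\int u\,d\delta\le\int u\,d\omega$ for every $u\in\mathrm{sbh}(O)$ (integrals with values in $\mathbb{R}\cup\{-\infty\}$). A set $E\subset\mathbb{R}^d$ is polar if there is $u\in\mathrm{sbh}_*(\mathbb{R}^d)$ such that $E\subset\{x\in\mathbb{R}^d: u(x)=-\infty\}$. If $E$ is not Borel, $\omega$ of the set above is understood as outer measure (equivalently, in the completion of $\omega$). *)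

theory Defs
  imports "HOL-Analysis.Analysis"
begin

text \<open>
  Since \<open>e2ennreal\<close> truncates negative values to \<open>0\<close>, the two terms below are the integrals
  of the positive and of the negative part. The integral is only used for functions that are
  bounded above on the support of a finite measure, so the first term is finite and the
  difference, with values in \<open>[-\<infinity>, \<infinity>)\<close>, is never of the form \<open>\<infinity> - \<infinity>\<close>.
\<close>

definition ereal_integral :: "'a measure \<Rightarrow> ('a \<Rightarrow> ereal) \<Rightarrow> ereal" where
  "ereal_integral M f =
     enn2ereal (\<integral>\<^sup>+ x. e2ennreal (f x) \<partial>M) - enn2ereal (\<integral>\<^sup>+ x. e2ennreal (- f x) \<partial>M)"

lemma ereal_integral_eq_lebesgue_integral:
  fixes f :: "'a \<Rightarrow> real"
  assumes "integrable M f"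
  shows "ereal_integral M (\<lambda>x. ereal (f x)) = ereal (\<integral>x. f x \<partial>M)"
proof -
  obtain r q where rq: "0 \<le> r" "0 \<le> q"
    "(\<integral>\<^sup>+ x. ennreal (f x) \<partial>M) = ennreal r" "(\<integral>\<^sup>+ x. ennreal (- f x) \<partial>M) = ennreal q"
    "(\<integral>x. f x \<partial>M) = r - q"
    using assms by (rule integrableE)
  then show ?thesis
    by (simp add: ereal_integral_def)
qed

text \<open>
  Upper semicontinuity together with the inequality of sub-mean values over all closed balls
  contained in \<open>U\<close>. Only the values on \<open>U\<close> matter; \<open>u\<close> may be identically \<open>-\<infinity>\<close> on
  components of \<open>U\<close>. In dimension one, on every component of \<open>U\<close>, this leaves exactly the
  finite convex functions and the constant \<open>-\<infinity>\<close>.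
\<close>

definition subharmonic_on :: "'a::euclidean_space set \<Rightarrow> ('a \<Rightarrow> ereal) \<Rightarrow> bool" where
  "subharmonic_on U u \<longleftrightarrow>
     (\<forall>x\<in>U. u x < \<infinity>) \<and>
     (\<forall>c. openin (top_of_set U) {x \<in> U. u x < c}) \<and>
     (\<forall>x r. 0 < r \<and> cball x r \<subseteq> U \<longrightarrow>
        u x \<le> ereal_integral (uniform_measure lborel (cball x r)) u)"

definition polar :: "'a::euclidean_space set \<Rightarrow> bool" where
  "polar E \<longleftrightarrow>
     (\<exists>u. subharmonic_on UNIV u \<and> (\<exists>x. u x \<noteq> -\<infinity>) \<and> E \<subseteq> {x. u x = -\<infinity>})"

definition measure_support :: "'a::topological_space measure \<Rightarrow> 'a set" where
  "measure_support M =
     {x \<in> space M. \<forall>V. open V \<and> x \<in> V \<longrightarrow> emeasure M (V \<inter> space M) > 0}"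

text \<open>
  The measures live on \<open>U\<close> itself, so that \<open>measure_support M \<subseteq> U\<close>. For an open set in
  Euclidean space, a Borel measure is Radon as soon as it is finite on compact sets.
\<close>

definition Meas_cmp :: "'a::euclidean_space set \<Rightarrow> 'a measure set" where
  "Meas_cmp U =
     {M. sets M = sets (restrict_space borel U) \<and>
         (\<forall>K. compact K \<and> K \<subseteq> U \<longrightarrow> emeasure M K < \<infinity>) \<and>
         compact (measure_support M)}"

definition sbh_balayage ::
    "'a::euclidean_space set \<Rightarrow> 'a measure \<Rightarrow> 'a measure \<Rightarrow> bool" where
  "sbh_balayage U \<delta> \<omega> \<longleftrightarrow>
     (\<forall>u. subharmonic_on U u \<longrightarrow> ereal_integral \<delta> u \<le> ereal_integral \<omega> u)"

end

theory Submission
  imports Defs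
begin

text \<open>
  Let \<open>u\<close> be subharmonic on the whole space, not identically \<open>- \<infinity>\<close>, with \<open>u = - \<infinity>\<close> on \<open>E\<close>. If some
  subharmonic function \<open>v\<close> were \<open>- \<infinity>\<close> on a part of \<open>E\<close> of positive \<open>\<omega>\<close>-measure but bounded below on the
  support of \<open>\<delta>\<close>, then the integral of \<open>v\<close> over \<open>\<delta>\<close> would be finite and the one over \<open>\<omega>\<close> would be \<open>- \<infinity>\<close>,
  contradicting the balayage. Such a \<open>v\<close> is obtained by localizing \<open>u\<close> near a point \<open>a\<close> outside the
  support of \<open>\<delta>\<close>: restrict the Riesz measure \<open>\<Delta>u\<close> to a small ball around \<open>a\<close> and take its Newtonian
  potential. It has the same singularities as \<open>u\<close> in that ball, and is bounded below outside a larger ball.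

  To carry this out without distributions or fundamental solutions, the Riesz measure is replaced by
  the nonnegative function \<open>(ball_mean r u - u) / r\<^sup>2\<close>, the Newtonian kernel is smoothed at a
  scale comparable to \<open>r\<close>, and \<open>r\<close> tends to zero. The resulting potentials are continuous and subharmonic
  (\<open>radial_potential_subharmonic\<close>), uniformly bounded below off a larger ball, and tend to \<open>- \<infinity>\<close> at every
  singularity of \<open>u\<close> close to \<open>a\<close> (\<open>swept_potential\<close>, where the sign is reversed: \<open>p\<close> is \<open>C - u\<close> and
  \<open>w\<close> is minus the potential). Both estimates are obtained by letting the averaging operator, which is
  self-adjoint (\<open>ball_mean_symmetric\<close>), act on a smooth radial test function instead of \<open>u\<close>: a bump
  function for the bound and a truncation of the kernel for the divergence. What averaging does to a
  smooth radial function is controlled by its Laplacian (\<open>radial_ball_mean_ge\<close>). Fatou's lemma then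
  plays the role of the contradiction above (\<open>balayage_null_near_point\<close>), and finally countably many balls
  cover the complement of the support of \<open>\<delta>\<close>.
\<close>

section \<open>The uniform distribution on the unit ball\<close>

definition unit_ball_measure :: "'a::euclidean_space measure" where
  "unit_ball_measure = uniform_measure lborel (cball 0 1)"

lemma measure_cball_scaled:
  fixes x :: "'a::euclidean_space"
  assumes "0 \<le> r"
  shows "measure lborel (cball x r) = r ^ DIM('a) * measure lborel (cball (0::'a) 1)"
  using assms by (simp add: content_cball)

lemma unit_ball_volume_pos: "0 < measure lborel (cball (0::'a::euclidean_space) 1)"
  using content_cball_pos[of 1 "0::'a"] by (simp add: measure_completion)

lemma sets_unit_ball_measure [simp, measurable_cong]: "sets unit_ball_measure = sets borel"
  by (simp add: unit_ball_measure_def)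

lemma space_unit_ball_measure [simp]: "space unit_ball_measure = UNIV"
  by (simp add: unit_ball_measure_def)

lemma emeasure_cball_fin: "emeasure lborel (cball (x::'a::euclidean_space) r) \<noteq> \<infinity>"
  using emeasure_lborel_cball_finite[of x r] by auto

lemma emeasure_unit_cball_nz: "emeasure lborel (cball (0::'a::euclidean_space) 1) \<noteq> 0"
  using unit_ball_volume_pos[where 'a='a] by (auto simp: measure_def)

lemma unit_ball_measure_finite: "finite_measure (unit_ball_measure :: 'a::euclidean_space measure)"
  and unit_ball_measure_total: "measure (unit_ball_measure :: 'a measure) UNIV = 1"
proof -
  have total: "emeasure (unit_ball_measure :: 'a measure) UNIV = 1"
    unfolding unit_ball_measure_def
    using emeasure_cball_fin[of "0::'a" 1] emeasure_unit_cball_nz[where 'a='a]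
    by (subst emeasure_uniform_measure) (auto simp: divide_self ennreal_divide_self top.not_eq_extremum)
  then show "finite_measure (unit_ball_measure :: 'a measure)"
    by (intro finite_measureI) simp
  show "measure (unit_ball_measure :: 'a measure) UNIV = 1"
    using total by (simp add: measure_def)
qed

lemma AE_unit_ball_measure: "AE z in unit_ball_measure. norm (z::'a::euclidean_space) \<le> 1"
proof -
  have "AE z in unit_ball_measure. z \<in> cball (0::'a) 1"
    unfolding unit_ball_measure_def
    by (intro AE_uniform_measureI) auto
  then show ?thesis by simp
qed

lemma unit_ball_measure_eq_density:
  "(unit_ball_measure :: 'a::euclidean_space measure)
     = density lborel (\<lambda>z. ennreal (indicator (cball 0 1) z / measure lborel (cball (0::'a) 1)))"
proof -
  have *: "emeasure lborel (cball (0::'a) 1) = ennreal (measure lborel (cball (0::'a) 1))"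
    using emeasure_cball_fin[of "0::'a" 1] by (simp add: emeasure_eq_ennreal_measure)
  have **: "(indicator (cball 0 1) z / ennreal (measure lborel (cball (0::'a) 1)) :: ennreal) =
      ennreal (indicator (cball 0 1) z / measure lborel (cball (0::'a) 1))" for z :: 'a
    using unit_ball_volume_pos[where 'a='a]
    by (auto simp: indicator_def divide_ennreal[symmetric])
  show ?thesis
    unfolding unit_ball_measure_def uniform_measure_def
    by (simp only: * **)
qed

lemma integral_unit_ball_measure:
  fixes f :: "'a::euclidean_space \<Rightarrow> real"
  assumes [measurable]: "f \<in> borel_measurable borel"
  shows "(\<integral>z. f z \<partial>unit_ball_measure)
    = (\<integral>z. indicator (cball 0 1) z * f z \<partial>lborel) / measure lborel (cball (0::'a) 1)"
proof -
  have "(\<integral>z. f z \<partial>unit_ball_measure)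
      = (\<integral>z. (indicator (cball 0 1) z / measure lborel (cball (0::'a) 1)) *\<^sub>R f z \<partial>lborel)"
    unfolding unit_ball_measure_eq_density
    using unit_ball_volume_pos[where 'a='a]
    by (subst integral_density) (auto intro!: borel_measurable_divide borel_measurable_indicator)
  also have "\<dots> = (\<integral>z. (indicator (cball 0 1) z * f z) / measure lborel (cball (0::'a) 1) \<partial>lborel)"
    by simp
  also have "\<dots> = (\<integral>z. indicator (cball 0 1) z * f z \<partial>lborel) / measure lborel (cball (0::'a) 1)"
    by simp
  finally show ?thesis .
qed

lemma uniform_measure_cball_eq_distr:
  fixes x :: "'a::euclidean_space"
  assumes r: "0 < r"
  shows "uniform_measure lborel (cball x r) = distr unit_ball_measure borel (\<lambda>z. x + r *\<^sub>R z)"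
proof (rule measure_eqI)
  fix A assume "A \<in> sets (uniform_measure lborel (cball x r))"
  then have [measurable]: "A \<in> sets borel" by simp
  have vim: "(\<lambda>z. x + r *\<^sub>R z) -` B \<in> sets borel" if [measurable]: "B \<in> sets borel" for B :: "'a set"
    using measurable_sets[of "\<lambda>z. x + r *\<^sub>R z" borel borel B] by simp
  have scale: "emeasure lborel B = ennreal (r ^ DIM('a)) * emeasure lborel ((\<lambda>z. x + r *\<^sub>R z) -` B)"
    if B[measurable]: "B \<in> sets borel" for B :: "'a set"
  proof -
    have "emeasure lborel B
        = emeasure (density (distr lborel borel (\<lambda>z. x + r *\<^sub>R z)) (\<lambda>_. ennreal (\<bar>r\<bar> ^ DIM('a)))) B"
      using lborel_affine[of r x] r by simp
    also have "\<dots> = ennreal (r ^ DIM('a)) * emeasure lborel ((\<lambda>z. x + r *\<^sub>R z) -` B)"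
      using r by (simp add: emeasure_density nn_integral_cmult nn_integral_distr emeasure_distr)
    finally show ?thesis .
  qed
  have im: "(\<lambda>z. x + r *\<^sub>R z) -` cball x r = cball 0 1"
    using r by (auto simp: dist_norm)
  have int: "(\<lambda>z. x + r *\<^sub>R z) -` (cball x r \<inter> A) = cball 0 1 \<inter> (\<lambda>z. x + r *\<^sub>R z) -` A"
    using im by auto
  have rp: "ennreal (r ^ DIM('a)) \<noteq> 0" "ennreal (r ^ DIM('a)) \<noteq> \<infinity>" using r by auto
  have "emeasure (uniform_measure lborel (cball x r)) A
      = emeasure lborel (cball x r \<inter> A) / emeasure lborel (cball x r)"
    by (simp add: emeasure_uniform_measure)
  also have "\<dots> = (ennreal (r ^ DIM('a)) * emeasure lborel (cball 0 1 \<inter> (\<lambda>z. x + r *\<^sub>R z) -` A))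
       / (ennreal (r ^ DIM('a)) * emeasure lborel (cball (0::'a) 1))"
    by (subst scale, simp, subst scale, simp, simp only: im int)
  also have "\<dots> = emeasure lborel (cball 0 1 \<inter> (\<lambda>z. x + r *\<^sub>R z) -` A) / emeasure lborel (cball (0::'a) 1)"
    using rp emeasure_unit_cball_nz[where 'a='a] emeasure_cball_fin[of "0::'a" 1]
    by (simp only: mult.commute[of "ennreal (r ^ DIM('a))"]) (intro divide_mult_eq, auto)
  also have "\<dots> = emeasure unit_ball_measure ((\<lambda>z. x + r *\<^sub>R z) -` A)"
    unfolding unit_ball_measure_def using vim[of A] by (simp add: emeasure_uniform_measure)
  also have "\<dots> = emeasure (distr unit_ball_measure borel (\<lambda>z. x + r *\<^sub>R z)) A"
    by (subst emeasure_distr) (simp_all add: unit_ball_measure_def)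
  finally show "emeasure (uniform_measure lborel (cball x r)) A
      = emeasure (distr unit_ball_measure borel (\<lambda>z. x + r *\<^sub>R z)) A" .
qed simp

lemma lborel_distr_uminus_euclidean:
  "distr lborel borel uminus = (lborel :: 'a::euclidean_space measure)"
  using lborel_affine[of "-1" "0::'a"] by (simp add: density_1)

text \<open>
  Symmetry of the ball is what later makes the averaging operator self-adjoint.
\<close>

lemma distr_uminus_unit_ball_measure:
  "distr unit_ball_measure borel uminus = (unit_ball_measure :: 'a::euclidean_space measure)"
proof (rule measure_eqI)
  fix A :: "'a set" assume "A \<in> sets (distr unit_ball_measure borel uminus)"
  then have [measurable]: "A \<in> sets borel" by simp
  have vim[measurable]: "uminus -` A \<in> sets borel"
    using measurable_sets[of uminus borel borel A] by simp
  have "emeasure lborel (cball 0 1 \<inter> A) = emeasure (distr lborel borel uminus) (cball 0 1 \<inter> A)"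
    by (simp add: lborel_distr_uminus_euclidean)
  also have "\<dots> = emeasure lborel (uminus -` (cball 0 1 \<inter> A))"
    by (subst emeasure_distr) auto
  also have "uminus -` (cball 0 1 \<inter> A) = cball 0 1 \<inter> uminus -` A"
    by auto
  finally show "emeasure (distr unit_ball_measure borel uminus) A = emeasure unit_ball_measure A"
    by (subst emeasure_distr) (simp_all add: unit_ball_measure_def emeasure_uniform_measure)
qed simp

lemma continuous_bounded_on_cball:
  fixes f :: "'a::euclidean_space \<Rightarrow> real"
  assumes "continuous_on UNIV f"
  shows "\<exists>B. \<forall>y\<in>cball a r. \<bar>f y\<bar> \<le> B"
proof -
  have "compact (f ` cball a r)"
    by (rule compact_continuous_image[OF continuous_on_subset[OF assms subset_UNIV] compact_cball])
  from compact_imp_bounded[OF this] show ?thesis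
    by (simp add: bounded_iff del: mem_cball)
qed

section \<open>Ball means of radial functions\<close>

lemma lborel_integral_translate:
  fixes f :: "'a::euclidean_space \<Rightarrow> real"
  assumes "integrable lborel f"
  shows "integrable lborel (\<lambda>y. f (y + a))" and "(\<integral>y. f (y + a) \<partial>lborel) = (\<integral>y. f y \<partial>lborel)"
proof -
  have [measurable]: "f \<in> borel_measurable borel" using assms by auto
  show "(\<integral>y. f (y + a) \<partial>lborel) = (\<integral>y. f y \<partial>lborel)"
    by (subst (2) lborel_distr_plus[of a, symmetric]) (simp add: integral_distr add.commute)
  have "integrable (distr lborel borel ((+) a)) f" using assms by (simp add: lborel_distr_plus)
  then have "integrable lborel (\<lambda>y. f (a + y))"
    by (subst (asm) integrable_distr_eq) auto
  then show "integrable lborel (\<lambda>y. f (y + a))"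
    by (simp add: add.commute)
qed

lemma integral_difference_zero:
  fixes X :: "'a::euclidean_space \<Rightarrow> real"
  assumes "integrable lborel X"
  shows "(\<integral>y. (X (y + a) - X y) / s \<partial>lborel) = 0"
  using lborel_integral_translate[OF assms, of a] assms by simp

text \<open>
  The boundary term vanishes because \<open>(1 - \<bar>z\<bar>\<^sup>2) / 2\<close> is zero on the unit sphere. No divergence
  theorem is used: extended by zero, the product \<open>X\<close> of this weight and \<open>G\<close> is Lipschitz with compact
  support, the integral of each difference quotient of \<open>X\<close> is zero by translation invariance, and
  dominated convergence turns this into the vanishing of the integral of the directional
  derivative of \<open>X\<close>.
\<close>

lemma ball_integration_by_parts:
  fixes e :: "'a::euclidean_space" and G G' :: "'a \<Rightarrow> real"
  assumes e: "norm e = 1"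
    and deriv: "\<And>y. ((\<lambda>s. G (y + s *\<^sub>R e)) has_real_derivative G' y) (at 0)"
    and contG: "continuous_on UNIV G" and contG': "continuous_on UNIV G'"
  shows "(\<integral>z. (z \<bullet> e) * G z \<partial>unit_ball_measure) = (\<integral>z. (1 - z \<bullet> z) / 2 * G' z \<partial>unit_ball_measure)"
proof -
  have [measurable]: "G \<in> borel_measurable borel" "G' \<in> borel_measurable borel"
    using contG contG' by (auto intro: borel_measurable_continuous_onI)
  define w where "w y = (1 - y \<bullet> y) / 2" for y :: 'a
  have [measurable]: "w \<in> borel_measurable borel" unfolding w_def by measurable
  define X where "X y = max 0 (w y) * G y" for y
  define D where "D y = indicator (cball 0 1) y * (w y * G' y - (y \<bullet> e) * G y)" for y
  have [measurable]: "X \<in> borel_measurable borel"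
    unfolding X_def by measurable
  have [measurable]: "D \<in> borel_measurable borel"
    unfolding D_def
    by (intro borel_measurable_times borel_measurable_diff borel_measurable_indicator borel_measurable_inner) auto
  have w_nonneg_iff: "0 \<le> w y \<longleftrightarrow> norm y \<le> 1" for y
    by (simp add: w_def dot_square_norm abs_square_le_1)
  have X_eq: "X = (\<lambda>y. indicator (cball 0 1) y *\<^sub>R (w y * G y))"
    using w_nonneg_iff by (auto simp: X_def indicator_def fun_eq_iff max_def)
  have intX: "integrable lborel X"
    unfolding X_eq
    by (intro borel_integrable_compact compact_cball continuous_intros continuous_on_subset[OF contG])
       (auto simp: w_def intro!: continuous_intros)
  have deriv_line: "((\<lambda>s. G (y + s *\<^sub>R e)) has_real_derivative G' (y + t *\<^sub>R e)) (at t)" for y t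
    using deriv[of "y + t *\<^sub>R e"] DERIV_shift[of "\<lambda>s. G (y + s *\<^sub>R e)" "G' (y + t *\<^sub>R e)" 0 t]
    by (simp add: algebra_simps)
  \<comment> \<open>The truncation \<open>max 0\<close> destroys differentiability on the unit sphere only, a null set.\<close>
  have derivX: "((\<lambda>s. X (y + s *\<^sub>R e)) has_real_derivative D y) (at 0)" if y: "norm y \<noteq> 1" for y
  proof (cases "norm y < 1")
    case True
    have "\<forall>\<^sub>F s in nhds 0. norm (y + s *\<^sub>R e) < 1"
      by (rule order_tendstoD[of _ "norm (y + 0 *\<^sub>R e)"])
         (use True in \<open>auto intro!: tendsto_eq_intros filterlim_ident\<close>)
    then have ev: "\<forall>\<^sub>F s in nhds 0. X (y + s *\<^sub>R e) = w (y + s *\<^sub>R e) * G (y + s *\<^sub>R e)"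
      by eventually_elim (simp add: X_eq)
    have "((\<lambda>s. w (y + s *\<^sub>R e)) has_real_derivative - (y \<bullet> e)) (at 0)"
    proof -
      have "w (y + s *\<^sub>R e) = (1 - (y \<bullet> y + 2 * s * (y \<bullet> e) + s\<^sup>2 * (e \<bullet> e))) / 2" for s
        by (simp add: w_def algebra_simps inner_commute[of e y] power2_eq_square)
      then have eq: "(\<lambda>s. w (y + s *\<^sub>R e)) = (\<lambda>s. (1 - (y \<bullet> y + 2 * s * (y \<bullet> e) + s\<^sup>2 * (e \<bullet> e))) / 2)"
        by (rule ext)
      show ?thesis
        unfolding eq by (auto intro!: derivative_eq_intros)
    qed
    from DERIV_mult[OF this deriv[of y]]
    have "((\<lambda>s. w (y + s *\<^sub>R e) * G (y + s *\<^sub>R e)) has_real_derivative D y) (at 0)"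
      using True by (simp add: D_def algebra_simps)
    then show ?thesis
      using DERIV_cong_ev[OF refl ev refl] by blast
  next
    case False
    then have "norm y > 1" using y by simp
    have "\<forall>\<^sub>F s in nhds 0. norm (y + s *\<^sub>R e) > 1"
      by (rule order_tendstoD[of _ "norm (y + 0 *\<^sub>R e)"])
         (use \<open>norm y > 1\<close> in \<open>auto intro!: tendsto_eq_intros filterlim_ident\<close>)
    then have ev: "\<forall>\<^sub>F s in nhds 0. X (y + s *\<^sub>R e) = 0"
      by eventually_elim (simp add: X_eq)
    have "D y = 0" using \<open>norm y > 1\<close> by (simp add: D_def)
    then show ?thesis
      using DERIV_cong_ev[OF refl ev refl, of 0] by simp
  qed
  define s where "s n = 1 / (real n + 1)" for n
  have s: "0 < s n" "s n \<le> 1" for n by (auto simp: s_def)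
  have s_lim: "filterlim s (at 0) sequentially"
    unfolding filterlim_at s_def by (auto simp: LIMSEQ_inverse_real_of_nat[unfolded inverse_eq_divide] intro!: always_eventually) (use LIMSEQ_inverse_real_of_nat in \<open>simp add: inverse_eq_divide add.commute\<close>)
  have AEs: "AE y in lborel. (\<lambda>n. (X (y + s n *\<^sub>R e) - X y) / s n) \<longlonglongrightarrow> D y"
  proof -
    have "sphere (0::'a) 1 \<in> null_sets lborel"
      using negligible_sphere[of "0::'a" 1] by (simp add: negligible_iff_null_sets null_sets_completion_iff)
    then have "AE y in lborel. y \<notin> sphere (0::'a) 1" by (rule AE_not_in)
    then show ?thesis
    proof eventually_elim
      case (elim y)
      then have "norm y \<noteq> 1" by simp
      from derivX[OF this] have "((\<lambda>h. (X (y + h *\<^sub>R e) - X y) / h) \<longlongrightarrow> D y) (at 0)"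
        by (simp add: DERIV_def)
      from filterlim_compose[OF this s_lim] show ?case .
    qed
  qed
  obtain B where B: "\<And>y. y \<in> cball 0 3 \<Longrightarrow> \<bar>G y\<bar> \<le> B"
    using continuous_bounded_on_cball[OF contG, of 0 3] by blast
  obtain B' where B': "\<And>y. y \<in> cball 0 3 \<Longrightarrow> \<bar>G' y\<bar> \<le> B'"
    using continuous_bounded_on_cball[OF contG', of 0 3] by blast
  have bound: "norm ((X (y + s n *\<^sub>R e) - X y) / s n) \<le> (3 * B + B') * indicator (cball 0 2) y" for y n
  proof (cases "norm y \<le> 2")
    case False
    have "norm (y + s n *\<^sub>R e) \<ge> norm y - norm (s n *\<^sub>R e)" by (rule norm_diff_ineq)
    moreover have "norm (s n *\<^sub>R e) \<le> 1" using s[of n] e by simp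
    ultimately have "\<not> norm (y + s n *\<^sub>R e) \<le> 1" using False by linarith
    then show ?thesis using False by (simp add: X_eq)
  next
    case True
    have in3: "y + t *\<^sub>R e \<in> cball 0 3" if "0 \<le> t" "t \<le> 1" for t
      using norm_triangle_ineq[of y "t *\<^sub>R e"] that e True by simp
    obtain \<xi> where \<xi>: "0 < \<xi>" "\<xi> < s n" "G (y + s n *\<^sub>R e) - G y = s n * G' (y + \<xi> *\<^sub>R e)"
      using MVT2[of 0 "s n" "\<lambda>s. G (y + s *\<^sub>R e)" "\<lambda>t. G' (y + t *\<^sub>R e)"] deriv_line s[of n] by auto
    have G1: "\<bar>G (y + s n *\<^sub>R e) - G y\<bar> \<le> s n * B'"
      using B'[OF in3[of \<xi>]] \<xi> s[of n] by (simp add: abs_mult)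
    have G2: "\<bar>G (y + s n *\<^sub>R e)\<bar> \<le> B" using B[OF in3[of "s n"]] s[of n] by simp
    have B0: "0 \<le> B" "0 \<le> B'" using B[of 0] B'[of 0] by auto
    have ye: "\<bar>y \<bullet> e\<bar> \<le> 2" using Cauchy_Schwarz_ineq2[of y e] e True by simp
    have ee: "e \<bullet> e = 1" using e by (simp add: norm_eq_1)
    have "w (y + s n *\<^sub>R e) - w y = - s n * ((y \<bullet> e) + s n / 2)"
      by (simp add: w_def algebra_simps ee inner_commute[of e y] power2_eq_square) (simp add: field_simps)
    then have "\<bar>w (y + s n *\<^sub>R e) - w y\<bar> = s n * \<bar>(y \<bullet> e) + s n / 2\<bar>"
      using s[of n] by (simp add: abs_mult)
    also have "\<dots> \<le> s n * 3"
      using ye s[of n] by (intro mult_left_mono) auto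
    finally have W1: "\<bar>max 0 (w (y + s n *\<^sub>R e)) - max 0 (w y)\<bar> \<le> s n * 3" by linarith
    have half: "(1 - a) / 2 \<le> 1" if "0 \<le> a" for a :: real using that by simp
    have "w y \<le> 1" unfolding w_def by (rule half) (rule inner_ge_zero)
    then have W2: "\<bar>max 0 (w y)\<bar> \<le> 1" by simp
    have "X (y + s n *\<^sub>R e) - X y = (max 0 (w (y + s n *\<^sub>R e)) - max 0 (w y)) * G (y + s n *\<^sub>R e)
        + max 0 (w y) * (G (y + s n *\<^sub>R e) - G y)"
      by (simp add: X_def algebra_simps)
    also have "\<bar>\<dots>\<bar> \<le> \<bar>max 0 (w (y + s n *\<^sub>R e)) - max 0 (w y)\<bar> * \<bar>G (y + s n *\<^sub>R e)\<bar>
        + \<bar>max 0 (w y)\<bar> * \<bar>G (y + s n *\<^sub>R e) - G y\<bar>"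
      by (metis abs_mult abs_triangle_ineq)
    also have "\<dots> \<le> (s n * 3) * B + 1 * (s n * B')"
      using W1 W2 G1 G2 B0 s[of n] by (intro add_mono mult_mono) auto
    also have "\<dots> = s n * (3 * B + B')" by (simp add: algebra_simps)
    finally show ?thesis using True s[of n] by (simp add: field_simps abs_divide)
  qed
  have lim: "(\<lambda>n. \<integral>y. (X (y + s n *\<^sub>R e) - X y) / s n \<partial>lborel) \<longlonglongrightarrow> (\<integral>y. D y \<partial>lborel)"
  proof (rule integral_dominated_convergence)
    show "integrable lborel (\<lambda>y. (3 * B + B') * indicator (cball (0::'a) 2) y)"
      by (intro integrable_mult_right integrable_real_indicator)
         (use emeasure_lborel_cball_finite[of "0::'a" 2] in auto)
  qed (use AEs bound in auto)
  have D0: "(\<integral>y. D y \<partial>lborel) = 0"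
    using lim unfolding integral_difference_zero[OF intX] by (simp only: LIMSEQ_const_iff)
  have i: "integrable lborel (\<lambda>y. indicator (cball (0::'a) 1) y * f y)"
    if "continuous_on UNIV f" for f :: "'a \<Rightarrow> real"
    using borel_integrable_compact[OF compact_cball continuous_on_subset[OF that subset_UNIV]]
    by (simp only: real_scaleR_def)
  have i1: "integrable lborel (\<lambda>y. indicator (cball 0 1) y * (w y * G' y))"
    unfolding w_def by (intro i continuous_intros contG') auto
  have i2: "integrable lborel (\<lambda>y. indicator (cball 0 1) y * ((y \<bullet> e) * G y))"
    by (intro i continuous_intros contG)
  have "(\<integral>y. indicator (cball 0 1) y * (w y * G' y) \<partial>lborel)
      - (\<integral>y. indicator (cball 0 1) y * ((y \<bullet> e) * G y) \<partial>lborel) = (\<integral>y. D y \<partial>lborel)"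
    by (subst Bochner_Integration.integral_diff[OF i1 i2, symmetric]) (simp only: D_def[abs_def] right_diff_distrib)
  then show ?thesis
    unfolding D0
    by (simp add: integral_unit_ball_measure w_def)
qed


text \<open>
  The mean of a function \<open>f\<close> over a ball of radius \<open>r\<close> about \<open>x\<close> is \<open>f x + c r\<^sup>2 \<Delta>f x + o(r\<^sup>2)\<close>;
  this is the constant \<open>c\<close>, in the form in which the integration by parts produces it.
\<close>

definition ball_mean_constant :: "'a::euclidean_space itself \<Rightarrow> real" where
  "ball_mean_constant _ = (\<integral>z. (1 - z \<bullet> z) / 2 \<partial>(unit_ball_measure :: 'a measure)) / 2"

lemma integrable_unit_ball_measure:
  fixes f :: "'a::euclidean_space \<Rightarrow> real"
  assumes "continuous_on UNIV f"
  shows "integrable unit_ball_measure f"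
proof -
  obtain B where B: "\<forall>y\<in>cball 0 1. \<bar>f y\<bar> \<le> B"
    using continuous_bounded_on_cball[OF assms] by blast
  have "AE z in unit_ball_measure. norm (f z) \<le> B"
    using AE_unit_ball_measure by eventually_elim (use B in auto)
  moreover have "f \<in> borel_measurable unit_ball_measure"
    using borel_measurable_continuous_onI[OF assms] by (simp add: unit_ball_measure_def)
  ultimately show ?thesis
    by (intro finite_measure.integrable_const_bound[OF unit_ball_measure_finite])
qed

lemma ball_mean_constant_pos: "0 < ball_mean_constant TYPE('a::euclidean_space)"
proof -
  interpret finite_measure "unit_ball_measure :: 'a measure" by (rule unit_ball_measure_finite)
  have i: "integrable (unit_ball_measure :: 'a measure) (\<lambda>z. (1 - z \<bullet> z) / 2)"
    by (intro integrable_unit_ball_measure continuous_intros) auto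
  have nn: "AE z in unit_ball_measure. 0 \<le> (1 - (z::'a) \<bullet> z) / 2"
    using AE_unit_ball_measure by eventually_elim (simp add: dot_square_norm abs_square_le_1)
  have "(\<integral>z. (1 - z \<bullet> z) / 2 \<partial>(unit_ball_measure :: 'a measure)) \<noteq> 0"
  proof
    assume "(\<integral>z. (1 - z \<bullet> z) / 2 \<partial>(unit_ball_measure :: 'a measure)) = 0"
    then have "AE z in unit_ball_measure. (1 - (z::'a) \<bullet> z) / 2 = 0"
      using integral_nonneg_eq_0_iff_AE[OF i nn] by simp
    then have "AE z in unit_ball_measure. z \<notin> ball (0::'a) 1"
      by eventually_elim (auto simp: norm_eq_1[symmetric])
    then have "emeasure (unit_ball_measure :: 'a measure) (ball 0 1) = 0"
      by (subst (asm) AE_iff_measurable[of "ball 0 1"]) auto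
    then have "emeasure lborel (ball (0::'a) 1) = 0"
      unfolding unit_ball_measure_def using emeasure_cball_fin[of "0::'a" 1]
      by (simp add: emeasure_uniform_measure Int_absorb1 ball_subset_cball)
    then show False
      using content_ball_pos[of 1 "0::'a"] by (simp add: measure_def)
  qed
  moreover have "0 \<le> (\<integral>z. (1 - z \<bullet> z) / 2 \<partial>(unit_ball_measure :: 'a measure))"
    by (rule integral_nonneg_AE[OF nn])
  ultimately show ?thesis by (simp add: ball_mean_constant_def)
qed

text \<open>
  For \<open>f y = h (\<bar>y\<bar>\<^sup>2)\<close> the left-hand side is the derivative in \<open>t\<close> of the mean of \<open>f\<close> over the ball of
  radius \<open>t\<close> about \<open>x\<close>; on the right \<open>4 s h'' s + 2 d h' s\<close> with \<open>s = \<bar>y\<bar>\<^sup>2\<close> is the Laplacian of \<open>f\<close>. The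
  identity is the sum over the coordinate directions of the integration by parts above, applied to
  the partial derivatives of \<open>f\<close>.
\<close>

lemma radial_gradient_mean:
  fixes x :: "'a::euclidean_space" and h1 h2 :: "real \<Rightarrow> real"
  assumes h1: "\<And>s. 0 \<le> s \<Longrightarrow> (h1 has_real_derivative h2 s) (at s)"
    and h2: "continuous_on {0..} h2"
  shows "(\<integral>z. 2 * h1 ((x + t *\<^sub>R z) \<bullet> (x + t *\<^sub>R z)) * ((x + t *\<^sub>R z) \<bullet> z) \<partial>unit_ball_measure)
    = t * (\<integral>z. (1 - z \<bullet> z) / 2 * (4 * ((x + t *\<^sub>R z) \<bullet> (x + t *\<^sub>R z)) * h2 ((x + t *\<^sub>R z) \<bullet> (x + t *\<^sub>R z))
        + 2 * real DIM('a) * h1 ((x + t *\<^sub>R z) \<bullet> (x + t *\<^sub>R z))) \<partial>unit_ball_measure)"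
proof -
  define q where "q z = x + t *\<^sub>R z" for z
  have contq: "continuous_on UNIV q" unfolding q_def by (intro continuous_intros)
  have contqq: "continuous_on UNIV (\<lambda>z. q z \<bullet> q z)" by (intro continuous_intros contq)
  have conth1: "continuous_on {0..} h1"
    by (rule DERIV_continuous_on, rule has_field_derivative_at_within, rule h1) simp
  have c1: "continuous_on UNIV (\<lambda>z. h1 (q z \<bullet> q z))"
    by (rule continuous_on_compose2[OF conth1 contqq]) auto
  have c2: "continuous_on UNIV (\<lambda>z. h2 (q z \<bullet> q z))"
    by (rule continuous_on_compose2[OF h2 contqq]) auto
  define G where "G i z = 2 * h1 (q z \<bullet> q z) * (q z \<bullet> i)" for i z
  define G' where "G' i z = t * (2 * h1 (q z \<bullet> q z) + 4 * h2 (q z \<bullet> q z) * (q z \<bullet> i)\<^sup>2)" for i z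
  have contG: "continuous_on UNIV (G i)" and contG': "continuous_on UNIV (G' i)" for i
    unfolding G_def G'_def by (intro continuous_intros c1 c2 contq)+
  have parts: "(\<integral>z. (z \<bullet> i) * G i z \<partial>unit_ball_measure) = (\<integral>z. (1 - z \<bullet> z) / 2 * G' i z \<partial>unit_ball_measure)"
    if i: "i \<in> Basis" for i :: 'a
  proof (rule ball_integration_by_parts)
    fix y
    have d1: "((\<lambda>s. q (y + s *\<^sub>R i) \<bullet> q (y + s *\<^sub>R i)) has_real_derivative 2 * t * (q y \<bullet> i)) (at 0)"
      unfolding q_def by (auto intro!: derivative_eq_intros simp: inner_commute algebra_simps)
    have d2: "((\<lambda>s. h1 (q (y + s *\<^sub>R i) \<bullet> q (y + s *\<^sub>R i))) has_real_derivative
        h2 (q y \<bullet> q y) * (2 * t * (q y \<bullet> i))) (at 0)"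
      using DERIV_chain2[OF _ d1, of h1 "h2 (q y \<bullet> q y)"] h1[of "q y \<bullet> q y"] by simp
    have d3: "((\<lambda>s. q (y + s *\<^sub>R i) \<bullet> i) has_real_derivative t) (at 0)"
      unfolding q_def using i by (auto intro!: derivative_eq_intros simp: inner_commute algebra_simps)
    show "((\<lambda>s. G i (y + s *\<^sub>R i)) has_real_derivative G' i y) (at 0)"
      using DERIV_cmult[OF DERIV_mult[OF d2 d3], of 2]
      by (simp add: G_def G'_def algebra_simps power2_eq_square)
  qed (use i contG contG' in auto)
  have sumG: "2 * h1 (q z \<bullet> q z) * (q z \<bullet> z) = (\<Sum>i\<in>Basis. (z \<bullet> i) * G i z)" for z
    by (subst euclidean_inner[of "q z" z]) (simp add: G_def sum_distrib_left algebra_simps)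
  have sumG': "(\<Sum>i\<in>Basis. (1 - z \<bullet> z) / 2 * G' i z)
      = t * ((1 - z \<bullet> z) / 2 * (4 * (q z \<bullet> q z) * h2 (q z \<bullet> q z) + 2 * real DIM('a) * h1 (q z \<bullet> q z)))" for z
  proof -
    have "(\<Sum>i\<in>Basis. G' i z) = t * (2 * real DIM('a) * h1 (q z \<bullet> q z) + 4 * h2 (q z \<bullet> q z) * (\<Sum>i\<in>Basis. (q z \<bullet> i)\<^sup>2))"
      by (simp add: G'_def sum.distrib sum_distrib_left[symmetric] algebra_simps)
    also have "(\<Sum>i\<in>Basis. (q z \<bullet> i)\<^sup>2) = q z \<bullet> q z"
      by (subst euclidean_inner[of "q z" "q z"]) (simp add: power2_eq_square)
    finally have "(\<Sum>i\<in>Basis. G' i z)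
        = t * (2 * real DIM('a) * h1 (q z \<bullet> q z) + 4 * h2 (q z \<bullet> q z) * (q z \<bullet> q z))" .
    then show ?thesis
      by (simp only: sum_distrib_left[symmetric]) (simp only: mult_ac add_ac)
  qed
  have "(\<integral>z. 2 * h1 (q z \<bullet> q z) * (q z \<bullet> z) \<partial>unit_ball_measure)
      = (\<Sum>i\<in>Basis. \<integral>z. (z \<bullet> i) * G i z \<partial>unit_ball_measure)"
    unfolding sumG
    by (intro Bochner_Integration.integral_sum integrable_unit_ball_measure continuous_intros contG)
  also have "\<dots> = (\<Sum>i\<in>Basis. \<integral>z. (1 - z \<bullet> z) / 2 * G' i z \<partial>unit_ball_measure)"
    by (intro sum.cong refl parts)
  also have "\<dots> = (\<integral>z. (\<Sum>i\<in>Basis. (1 - z \<bullet> z) / 2 * G' i z) \<partial>unit_ball_measure)"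
    by (intro Bochner_Integration.integral_sum[symmetric] integrable_unit_ball_measure continuous_intros contG') auto
  finally show ?thesis
    unfolding sumG' by (simp add: q_def)
qed

text \<open>
  A quantitative sub-mean value property: a lower bound for the Laplacian becomes a lower bound of
  order \<open>r\<^sup>2\<close> for the excess of the ball mean over the value at the centre. With \<open>m = 0\<close> it says that
  smooth radial functions with nonnegative Laplacian satisfy the sub-mean value inequality, also for
  balls whose centre is not the centre of symmetry. It follows by integrating the preceding identity
  in the radius from \<open>0\<close> to \<open>r\<close>.
\<close>

lemma radial_ball_mean_ge:
  fixes x :: "'a::euclidean_space" and h h1 h2 :: "real \<Rightarrow> real"
  assumes h: "\<And>s. 0 \<le> s \<Longrightarrow> (h has_real_derivative h1 s) (at s)"
    and h1: "\<And>s. 0 \<le> s \<Longrightarrow> (h1 has_real_derivative h2 s) (at s)"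
    and h2: "continuous_on {0..} h2"
    and r: "0 \<le> r"
    and lap: "\<And>y. y \<in> cball x r \<Longrightarrow> m \<le> 4 * (y \<bullet> y) * h2 (y \<bullet> y) + 2 * real DIM('a) * h1 (y \<bullet> y)"
  shows "h (x \<bullet> x) + ball_mean_constant TYPE('a) * m * r\<^sup>2
    \<le> (\<integral>z. h ((x + r *\<^sub>R z) \<bullet> (x + r *\<^sub>R z)) \<partial>unit_ball_measure)"
proof -
  interpret finite_measure "unit_ball_measure :: 'a measure" by (rule unit_ball_measure_finite)
  define q where "q t z = x + t *\<^sub>R z" for t z
  have contq: "continuous_on S (\<lambda>p. q (fst p) (snd p))" for S unfolding q_def by (intro continuous_intros)
  have conth: "continuous_on {0..} h"
    by (rule DERIV_continuous_on, rule has_field_derivative_at_within, rule h) simp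
  have conth1: "continuous_on {0..} h1"
    by (rule DERIV_continuous_on, rule has_field_derivative_at_within, rule h1) simp
  define g where "g t z = 2 * h1 (q t z \<bullet> q t z) * (q t z \<bullet> z)" for t z
  have contg: "continuous_on S (\<lambda>p. g (fst p) (snd p))" for S
    unfolding g_def
    by (intro continuous_intros contq continuous_on_compose2[OF conth1]) auto
  have contg2: "continuous_on S (\<lambda>z. g t z)" for S t
    using continuous_on_compose2[OF contg[of UNIV], of S "\<lambda>z. (t, z)"]
    by (simp add: continuous_on_Pair)
  have contg1: "continuous_on S (\<lambda>t. g t z)" for S z
    using continuous_on_compose2[OF contg[of UNIV], of S "\<lambda>t. (t, z)"]
    by (simp add: continuous_on_Pair)
  let ?V = "measure lborel (cball (0::'a) 1)"
  let ?I = "\<lambda>t. indicator {0..r} t :: real"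
  let ?J = "\<lambda>z. indicator (cball 0 1) z :: real"
  have ftc: "(\<integral>t. g t z * ?I t \<partial>lborel) = h (q r z \<bullet> q r z) - h (x \<bullet> x)" for z
  proof -
    have d: "((\<lambda>t. h (q t z \<bullet> q t z)) has_real_derivative g t z) (at t)" for t
    proof -
      have "((\<lambda>t. q t z \<bullet> q t z) has_real_derivative 2 * (q t z \<bullet> z)) (at t)"
        unfolding q_def by (auto intro!: derivative_eq_intros simp: inner_commute algebra_simps)
      from DERIV_chain2[OF h this] show ?thesis by (simp add: g_def mult_ac)
    qed
    have "(\<integral>t. g t z * ?I t \<partial>lborel) = h (q r z \<bullet> q r z) - h (q 0 z \<bullet> q 0 z)"
      using contg1[of UNIV z] continuous_on_eq_continuous_at[OF open_UNIV]
      by (intro integral_FTC_Icc_real r d) auto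
    then show ?thesis by (simp add: q_def)
  qed
  have slice: "t * m * (2 * ball_mean_constant TYPE('a)) \<le> (\<integral>z. g t z \<partial>unit_ball_measure)" if t: "0 \<le> t" "t \<le> r" for t
  proof -
    let ?L = "\<lambda>z. 4 * (q t z \<bullet> q t z) * h2 (q t z \<bullet> q t z) + 2 * real DIM('a) * h1 (q t z \<bullet> q t z)"
    have contqt: "continuous_on UNIV (\<lambda>z. q t z \<bullet> q t z)" unfolding q_def by (intro continuous_intros)
    have "(\<integral>z. (1 - z \<bullet> z) / 2 * m \<partial>(unit_ball_measure :: 'a measure)) \<le> (\<integral>z. (1 - z \<bullet> z) / 2 * ?L z \<partial>unit_ball_measure)"
    proof (rule Bochner_Integration.integral_mono_AE)
      show "integrable (unit_ball_measure :: 'a measure) (\<lambda>z. (1 - z \<bullet> z) / 2 * m)"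
        by (intro integrable_unit_ball_measure continuous_intros) auto
      show "integrable unit_ball_measure (\<lambda>z. (1 - z \<bullet> z) / 2 * ?L z)"
        by (intro integrable_unit_ball_measure continuous_intros contqt
              continuous_on_compose2[OF conth1 contqt] continuous_on_compose2[OF h2 contqt]) auto
      show "AE z in unit_ball_measure. (1 - z \<bullet> z) / 2 * m \<le> (1 - z \<bullet> z) / 2 * ?L z"
        using AE_unit_ball_measure
      proof eventually_elim
        case (elim z)
        have "q t z \<in> cball x r"
          using t elim mult_mono[of t r "norm z" 1] by (simp add: q_def dist_norm)
        from lap[OF this] show ?case
          using elim by (intro mult_left_mono) (auto simp: dot_square_norm abs_square_le_1)
      qed
    qed
    also have "(\<integral>z. (1 - z \<bullet> z) / 2 * m \<partial>(unit_ball_measure :: 'a measure)) = 2 * ball_mean_constant TYPE('a) * m"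
      unfolding ball_mean_constant_def by (subst Bochner_Integration.integral_mult_left_zero) simp
    finally have "t * (2 * ball_mean_constant TYPE('a) * m) \<le> t * (\<integral>z. (1 - z \<bullet> z) / 2 * ?L z \<partial>unit_ball_measure)"
      using t by (intro mult_left_mono)
    also have "\<dots> = (\<integral>z. g t z \<partial>unit_ball_measure)"
      unfolding g_def q_def by (rule radial_gradient_mean[OF h1 h2, symmetric]) auto
    finally show ?thesis by (simp add: mult_ac)
  qed
  have int2: "integrable (lborel \<Otimes>\<^sub>M lborel) (\<lambda>(t, z). ?I t * (?J z * g t z))"
  proof -
    have "integrable lborel (\<lambda>p. indicator ({0..r} \<times> cball (0::'a) 1) p *\<^sub>R g (fst p) (snd p))"
      by (intro borel_integrable_compact compact_Times contg) auto
    moreover have "(\<lambda>p. indicator ({0..r} \<times> cball (0::'a) 1) p *\<^sub>R g (fst p) (snd p)) = (\<lambda>(t, z). ?I t * (?J z * g t z))"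
      by (auto simp: fun_eq_iff indicator_def)
    ultimately show ?thesis by (simp add: lborel_prod)
  qed
  have inth: "integrable unit_ball_measure (\<lambda>z. h (q r z \<bullet> q r z))"
    unfolding q_def
    by (intro integrable_unit_ball_measure continuous_on_compose2[OF conth]) (auto intro!: continuous_intros)
  have [measurable]: "(\<lambda>z. h (q r z \<bullet> q r z)) \<in> borel_measurable borel"
    using borel_measurable_integrable[OF inth] by simp
  have gm[measurable]: "g t \<in> borel_measurable borel" for t
    using contg2[of UNIV t] by (rule borel_measurable_continuous_onI)
  have "(\<integral>z. h (q r z \<bullet> q r z) \<partial>unit_ball_measure) - h (x \<bullet> x)
      = (\<integral>z. h (q r z \<bullet> q r z) - h (x \<bullet> x) \<partial>unit_ball_measure)"
    using inth by (simp add: unit_ball_measure_total)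
  also have "\<dots> = (\<integral>z. ?J z * (h (q r z \<bullet> q r z) - h (x \<bullet> x)) \<partial>lborel) / ?V"
    by (rule integral_unit_ball_measure) measurable
  also have "\<dots> = (\<integral>z. (\<integral>t. ?I t * (?J z * g t z) \<partial>lborel) \<partial>lborel) / ?V"
  proof -
    have "?J z * (h (q r z \<bullet> q r z) - h (x \<bullet> x)) = (\<integral>t. ?I t * (?J z * g t z) \<partial>lborel)" for z
    proof -
      have "?J z * (h (q r z \<bullet> q r z) - h (x \<bullet> x)) = ?J z * (\<integral>t. g t z * ?I t \<partial>lborel)"
        by (simp only: ftc)
      also have "\<dots> = (\<integral>t. ?J z * (g t z * ?I t) \<partial>lborel)"
        by (rule integral_mult_right_zero[symmetric])
      also have "\<dots> = (\<integral>t. ?I t * (?J z * g t z) \<partial>lborel)"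
        by (intro Bochner_Integration.integral_cong) auto
      finally show ?thesis .
    qed
    then show ?thesis by (simp only:)
  qed
  also have "(\<integral>z. (\<integral>t. ?I t * (?J z * g t z) \<partial>lborel) \<partial>lborel) = (\<integral>t. (\<integral>z. ?I t * (?J z * g t z) \<partial>lborel) \<partial>lborel)"
    by (rule lborel_pair.Fubini_integral[OF int2])
  also have "\<dots> / ?V = (\<integral>t. ?I t * (\<integral>z. g t z \<partial>unit_ball_measure) \<partial>lborel)"
    by (simp add: integral_unit_ball_measure)
  also have "\<dots> \<ge> (\<integral>t. (t * m * (2 * ball_mean_constant TYPE('a))) * ?I t \<partial>lborel)"
  proof (rule Bochner_Integration.integral_mono)
    have "integrable lborel (\<lambda>t. \<integral>z. ?I t * (?J z * g t z) \<partial>lborel)"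
      using lborel_pair.integrable_fst[OF int2] by simp
    then have "integrable lborel (\<lambda>t. (\<integral>z. ?I t * (?J z * g t z) \<partial>lborel) / ?V)"
      by simp
    then show "integrable lborel (\<lambda>t. ?I t * (\<integral>z. g t z \<partial>unit_ball_measure))"
      by (simp add: integral_unit_ball_measure)
    show "integrable lborel (\<lambda>t. (t * m * (2 * ball_mean_constant TYPE('a))) * ?I t)"
    proof -
      have "continuous_on {0..r} (\<lambda>t. t * m * (2 * ball_mean_constant TYPE('a)))"
        by (intro continuous_intros)
      from borel_integrable_compact[OF compact_Icc this] show ?thesis
        by (simp only: real_scaleR_def mult.commute)
    qed
    show "(t * m * (2 * ball_mean_constant TYPE('a))) * ?I t \<le> ?I t * (\<integral>z. g t z \<partial>unit_ball_measure)" for t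
      using slice[of t] by (auto simp: indicator_def)
  qed
  also have "(\<integral>t. (t * m * (2 * ball_mean_constant TYPE('a))) * ?I t \<partial>lborel)
      = r\<^sup>2 * m * ball_mean_constant TYPE('a) - 0\<^sup>2 * m * ball_mean_constant TYPE('a)"
    using r by (intro integral_FTC_Icc_real) (auto intro!: derivative_eq_intros)
  finally show ?thesis by (simp add: q_def mult_ac)
qed

lemma integral_uniform_measure_cball:
  fixes f :: "'a::euclidean_space \<Rightarrow> real"
  assumes r: "0 < r" and [measurable]: "f \<in> borel_measurable borel"
  shows "(\<integral>y. f y \<partial>uniform_measure lborel (cball x r)) = (\<integral>z. f (x + r *\<^sub>R z) \<partial>unit_ball_measure)"
  unfolding uniform_measure_cball_eq_distr[OF r]
  by (subst integral_distr) (auto simp: measurable_cong_sets[OF sets_unit_ball_measure])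

section \<open>Potentials with radial kernels\<close>

text \<open>
  The measure lives on a bounded set, so for bounded \<open>x\<close> the arguments of \<open>\<phi>\<close> stay in a compact interval,
  on which \<open>\<phi>\<close> is bounded. This gives both integrability and a dominating constant for continuity.
\<close>

lemma radial_potential_integrable:
  fixes \<gamma> :: "'a::euclidean_space measure" and \<phi> :: "real \<Rightarrow> real"
  assumes fin: "finite_measure \<gamma>" and sets: "sets \<gamma> = sets borel"
    and bdd: "AE y in \<gamma>. y \<in> ball a R" and cont: "continuous_on {0..} \<phi>"
  shows "integrable \<gamma> (\<lambda>y. \<phi> ((x - y) \<bullet> (x - y)))"
    and "continuous_on UNIV (\<lambda>x. \<integral>y. \<phi> ((x - y) \<bullet> (x - y)) \<partial>\<gamma>)"
proof -
  have meas[measurable]: "(\<lambda>y. \<phi> ((x - y) \<bullet> (x - y))) \<in> borel_measurable \<gamma>" for x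
  proof -
    have "continuous_on UNIV (\<lambda>y. \<phi> ((x - y) \<bullet> (x - y)))"
      by (rule continuous_on_compose2[OF cont]) (auto intro!: continuous_intros)
    then show ?thesis
      by (simp add: measurable_cong_sets[OF sets] borel_measurable_continuous_onI)
  qed
  have bound: "\<exists>B. \<forall>x\<in>cball 0 C. AE y in \<gamma>. \<bar>\<phi> ((x - y) \<bullet> (x - y))\<bar> \<le> B" for C
  proof -
    have "compact (\<phi> ` {0..(C + norm a + R)\<^sup>2})"
      by (rule compact_continuous_image[OF continuous_on_subset[OF cont]]) auto
    then obtain B where B: "\<forall>s\<in>{0..(C + norm a + R)\<^sup>2}. \<bar>\<phi> s\<bar> \<le> B"
      using compact_imp_bounded by (fastforce simp: bounded_iff)
    have "AE y in \<gamma>. \<bar>\<phi> ((x - y) \<bullet> (x - y))\<bar> \<le> B" if x: "x \<in> cball 0 C" for x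
      using bdd
    proof eventually_elim
      case (elim y)
      have "norm (x - y) \<le> norm x + norm y" by (rule norm_triangle_ineq4)
      moreover have "norm y \<le> norm a + norm (y - a)" by (metis add.commute diff_add_cancel norm_triangle_ineq)
      ultimately have "norm (x - y) \<le> C + norm a + R"
        using x elim by (simp add: dist_norm norm_minus_commute)
      then have "(norm (x - y))\<^sup>2 \<le> (C + norm a + R)\<^sup>2" by (intro power_mono) auto
      then show ?case using B by (simp add: dot_square_norm)
    qed
    then show ?thesis by blast
  qed
  show int: "integrable \<gamma> (\<lambda>y. \<phi> ((x - y) \<bullet> (x - y)))" for x
  proof -
    obtain B where "\<forall>x'\<in>cball 0 (norm x). AE y in \<gamma>. \<bar>\<phi> ((x' - y) \<bullet> (x' - y))\<bar> \<le> B"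
      using bound by blast
    then have "AE y in \<gamma>. norm (\<phi> ((x - y) \<bullet> (x - y))) \<le> B" by simp
    from finite_measure.integrable_const_bound[OF fin this meas] show ?thesis .
  qed
  show "continuous_on UNIV (\<lambda>x. \<integral>y. \<phi> ((x - y) \<bullet> (x - y)) \<partial>\<gamma>)"
  proof (rule continuous_on_sequentiallyI)
    fix u :: "nat \<Rightarrow> 'a" and l assume u: "u \<longlonglongrightarrow> l"
    obtain C where C: "\<And>n. norm (u n) \<le> C"
      using convergent_imp_bounded[OF u] by (auto simp: bounded_iff)
    obtain B where B: "\<forall>x\<in>cball 0 C. AE y in \<gamma>. \<bar>\<phi> ((x - y) \<bullet> (x - y))\<bar> \<le> B"
      using bound by blast
    show "(\<lambda>n. \<integral>y. \<phi> ((u n - y) \<bullet> (u n - y)) \<partial>\<gamma>) \<longlonglongrightarrow> (\<integral>y. \<phi> ((l - y) \<bullet> (l - y)) \<partial>\<gamma>)"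
    proof (rule integral_dominated_convergence)
      show "integrable \<gamma> (\<lambda>_. B)" by (rule finite_measure.integrable_const[OF fin])
      show "AE y in \<gamma>. (\<lambda>n. \<phi> ((u n - y) \<bullet> (u n - y))) \<longlonglongrightarrow> \<phi> ((l - y) \<bullet> (l - y))"
      proof (rule AE_I2)
        fix y :: 'a
        have "continuous_on UNIV (\<lambda>x. \<phi> ((x - y) \<bullet> (x - y)))"
          by (rule continuous_on_compose2[OF cont]) (auto intro!: continuous_intros)
        then show "(\<lambda>n. \<phi> ((u n - y) \<bullet> (u n - y))) \<longlonglongrightarrow> \<phi> ((l - y) \<bullet> (l - y))"
          using u by (auto simp: continuous_on_sequentially o_def)
      qed
      show "AE y in \<gamma>. norm (\<phi> ((u n - y) \<bullet> (u n - y))) \<le> B" for n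
        using B C[of n] by auto
    qed measurable
  qed
qed

text \<open>
  The kernel has nonpositive Laplacian, so its negative satisfies the sub-mean value inequality, and
  by Fubini the inequality survives integration against a positive measure.
\<close>

lemma radial_potential_subharmonic:
  fixes \<gamma> :: "'a::euclidean_space measure" and \<kappa> \<kappa>1 \<kappa>2 :: "real \<Rightarrow> real"
  assumes fin: "finite_measure \<gamma>" and sets: "sets \<gamma> = sets borel"
    and bdd: "AE y in \<gamma>. y \<in> ball a R"
    and d1: "\<And>s. 0 \<le> s \<Longrightarrow> (\<kappa> has_real_derivative \<kappa>1 s) (at s)"
    and d2: "\<And>s. 0 \<le> s \<Longrightarrow> (\<kappa>1 has_real_derivative \<kappa>2 s) (at s)"
    and c2: "continuous_on {0..} \<kappa>2"
    and lap: "\<And>s. 0 \<le> s \<Longrightarrow> 4 * s * \<kappa>2 s + 2 * real DIM('a) * \<kappa>1 s \<le> 0"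
  shows "subharmonic_on U (\<lambda>x. ereal (- (\<integral>y. \<kappa> ((x - y) \<bullet> (x - y)) \<partial>\<gamma>)))"
proof -
  define w where "w x = (\<integral>y. \<kappa> ((x - y) \<bullet> (x - y)) \<partial>\<gamma>)" for x
  have cont: "continuous_on {0..} \<kappa>"
    by (rule DERIV_continuous_on, rule has_field_derivative_at_within, rule d1) simp
  note int = radial_potential_integrable(1)[OF fin sets bdd cont]
  have contw: "continuous_on UNIV w"
    unfolding w_def by (rule radial_potential_integrable(2)[OF fin sets bdd cont])
  have contw': "continuous_on U (\<lambda>x. ereal (- w x))"
    by (intro continuous_on_ereal continuous_on_minus continuous_on_subset[OF contw]) auto
  have opn: "openin (top_of_set U) {x \<in> U. ereal (- w x) < c}" for c
    using continuous_openin_preimage_gen[OF contw' open_lessThan[of c]]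
    by (simp add: vimage_def Int_def)
  have sub: "ereal (- w x) \<le> ereal_integral (uniform_measure lborel (cball x r)) (\<lambda>x. ereal (- w x))"
    if r: "0 < r" for x r
  proof -
    interpret N: finite_measure "unit_ball_measure :: 'a measure" by (rule unit_ball_measure_finite)
    interpret G: finite_measure \<gamma> by (rule fin)
    interpret P: pair_sigma_finite "unit_ball_measure :: 'a measure" \<gamma> ..
    have contw_r: "continuous_on UNIV (\<lambda>z. w (x + r *\<^sub>R z))"
      by (rule continuous_on_compose2[OF contw]) (auto intro!: continuous_intros)
    have [measurable]: "w \<in> borel_measurable borel"
      using contw by (rule borel_measurable_continuous_onI)
    have "integrable (distr unit_ball_measure borel (\<lambda>z. x + r *\<^sub>R z)) w"
      using integrable_unit_ball_measure[OF contw_r]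
      by (subst integrable_distr_eq) (auto simp: measurable_cong_sets[OF sets_unit_ball_measure])
    then have intw: "integrable (uniform_measure lborel (cball x r)) (\<lambda>x. - w x)"
      unfolding uniform_measure_cball_eq_distr[OF r] by simp
    let ?k = "\<lambda>z y. \<kappa> ((x + r *\<^sub>R z - y) \<bullet> (x + r *\<^sub>R z - y))"
    have contk: "continuous_on UNIV (\<lambda>p. ?k (fst p) (snd p))"
      by (rule continuous_on_compose2[OF cont]) (auto intro!: continuous_intros)
    have int2: "integrable (unit_ball_measure \<Otimes>\<^sub>M \<gamma>) (\<lambda>(z, y). ?k z y)"
    proof (rule P.Fubini_integrable)
      have "(\<lambda>p. ?k (fst p) (snd p)) \<in> borel_measurable (borel \<Otimes>\<^sub>M borel)"
        using contk by (simp add: borel_prod borel_measurable_continuous_onI)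
      then show "(\<lambda>(z, y). ?k z y) \<in> borel_measurable (unit_ball_measure \<Otimes>\<^sub>M \<gamma>)"
        by (simp add: measurable_cong_sets[OF sets_pair_measure_cong[OF sets_unit_ball_measure sets]] case_prod_beta')
      have ca: "continuous_on {0..} (\<lambda>s. \<bar>\<kappa> s\<bar>)" by (intro continuous_intros cont)
      have "continuous_on UNIV (\<lambda>z. (\<integral>y. \<bar>?k z y\<bar> \<partial>\<gamma>))"
        by (rule continuous_on_compose2[OF radial_potential_integrable(2)[OF fin sets bdd ca]])
           (auto intro!: continuous_intros)
      then show "integrable unit_ball_measure (\<lambda>z. \<integral>y. norm (case (z, y) of (z, y) \<Rightarrow> ?k z y) \<partial>\<gamma>)"
        by (simp add: integrable_unit_ball_measure)
      show "AE z in unit_ball_measure. integrable \<gamma> (\<lambda>y. case (z, y) of (z, y) \<Rightarrow> ?k z y)"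
        using int by simp
    qed
    have "(\<integral>z. w (x + r *\<^sub>R z) \<partial>unit_ball_measure) = (\<integral>y. (\<integral>z. ?k z y \<partial>unit_ball_measure) \<partial>\<gamma>)"
      unfolding w_def using P.Fubini_integral[OF int2] by simp
    also have "\<dots> \<le> (\<integral>y. \<kappa> ((x - y) \<bullet> (x - y)) \<partial>\<gamma>)"
    proof (rule Bochner_Integration.integral_mono)
      show "integrable \<gamma> (\<lambda>y. \<integral>z. ?k z y \<partial>unit_ball_measure)"
        using P.integrable_snd[OF int2] by simp
      fix y
      have "- \<kappa> ((x - y) \<bullet> (x - y)) + ball_mean_constant TYPE('a) * 0 * r\<^sup>2
          \<le> (\<integral>z. - \<kappa> ((x - y + r *\<^sub>R z) \<bullet> (x - y + r *\<^sub>R z)) \<partial>unit_ball_measure)"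
      proof (rule radial_ball_mean_ge[of "\<lambda>s. - \<kappa> s" "\<lambda>s. - \<kappa>1 s" "\<lambda>s. - \<kappa>2 s" r "x - y" 0])
        show "0 \<le> 4 * (z \<bullet> z) * - \<kappa>2 (z \<bullet> z) + 2 * real DIM('a) * - \<kappa>1 (z \<bullet> z)" for z :: 'a
          using lap[of "z \<bullet> z"] by simp
      qed (use d1 d2 c2 r in \<open>auto intro!: DERIV_minus continuous_intros\<close>)
      then show "(\<integral>z. ?k z y \<partial>unit_ball_measure) \<le> \<kappa> ((x - y) \<bullet> (x - y))"
        by (simp add: algebra_simps)
    qed (rule int)
    finally have "(\<integral>z. w (x + r *\<^sub>R z) \<partial>unit_ball_measure) \<le> w x"
      by (simp only: w_def[of x])
    then have "- w x \<le> (\<integral>y. - w y \<partial>uniform_measure lborel (cball x r))"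
      using integral_uniform_measure_cball[OF r, of w x] by simp
    then show ?thesis
      by (simp only: ereal_integral_eq_lebesgue_integral[OF intw] ereal_less_eq)
  qed
  show ?thesis
    unfolding subharmonic_on_def using opn sub by (simp add: w_def)
qed

section \<open>Newtonian kernels and their truncation\<close>

lemma DERIV_positive_part_power:
  "((\<lambda>x::real. max 0 x ^ Suc (Suc n)) has_real_derivative real (Suc (Suc n)) * max 0 x ^ Suc n) (at x)"
proof -
  consider "x < 0" | "x > 0" | "x = 0" by linarith
  then show ?thesis
  proof cases
    case 1
    have ev: "\<forall>\<^sub>F y in nhds x. max 0 y ^ Suc (Suc n) = 0"
      using eventually_nhds_in_open[of "{..<0}" x] 1 by (auto elim!: eventually_mono)
    show ?thesis
      using 1 by (subst DERIV_cong_ev[OF refl ev refl]) simp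
  next
    case 2
    have ev: "\<forall>\<^sub>F y in nhds x. max 0 y ^ Suc (Suc n) = y ^ Suc (Suc n)"
      using eventually_nhds_in_open[of "{0<..}" x] 2 by (auto elim!: eventually_mono)
    show ?thesis
      using 2 DERIV_pow[of "Suc (Suc n)"] by (subst DERIV_cong_ev[OF refl ev refl]) simp
  next
    case 3
    have "(\<lambda>h::real. max 0 h ^ Suc (Suc n) / h) = (\<lambda>h. max 0 h ^ Suc n)"
      by (auto simp: fun_eq_iff max_def)
    moreover have "((\<lambda>h::real. max 0 h ^ Suc n) \<longlongrightarrow> 0) (at 0)"
      by (auto intro!: tendsto_eq_intros)
    ultimately show ?thesis using 3 by (simp add: DERIV_def)
  qed
qed

text \<open>
  Starting the integral at \<open>-e\<close> instead of \<open>0\<close> makes \<open>0\<close> an interior point, so that the derivative there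
  is two-sided.
\<close>

lemma antiderivative_right_half_line:
  fixes f :: "real \<Rightarrow> real"
  assumes e: "0 < e" and f: "continuous_on {-e..} f"
  shows "\<exists>F. \<forall>s\<ge>0. (F has_real_derivative f s) (at s)"
proof -
  have "((\<lambda>t. integral {-e..t} f) has_real_derivative f s) (at s)" if s: "0 \<le> s" for s
  proof -
    have "((\<lambda>t. integral {-e..t} f) has_real_derivative f s) (at s within {-e..s + 1})"
      using s e by (intro integral_has_real_derivative continuous_on_subset[OF f]) auto
    moreover have "at s within {-e..s + 1} = at s"
      using s e by (intro at_within_interior) auto
    ultimately show ?thesis by simp
  qed
  then show ?thesis by blast
qed


text \<open>
  With \<open>d\<close> half the dimension, \<open>- K (\<bar>x\<bar>\<^sup>2)\<close> is, up to normalization, the Newtonian kernel smoothed at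
  scale \<open>sqrt e\<close>. Describing it through the derivative of \<open>K\<close> covers the linear, the logarithmic and
  the power kernels of dimensions one, two and higher at once.
\<close>

lemma newton_kernel_exists:
  fixes e d :: real
  assumes e: "0 < e"
  shows "\<exists>K. \<forall>s\<ge>0. (K has_real_derivative (s + e) powr (- d)) (at s)"
  by (rule antiderivative_right_half_line[of "e / 2"])
     (use e in \<open>auto intro!: continuous_intros\<close>)

text \<open>
  The third identity says that the Laplacian of the smoothed kernel is negative: it is a
  negative multiple of a smoothed Dirac mass.
\<close>

lemma newton_kernel_derivatives:
  fixes d e s :: real
  assumes e: "0 < e"
  shows "0 \<le> s \<Longrightarrow> ((\<lambda>s. - ((s + e) powr (- d))) has_real_derivative d * (s + e) powr (- d - 1)) (at s)"
    and "continuous_on {0..} (\<lambda>s. d * (s + e) powr (- d - 1))"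
    and "0 \<le> s \<Longrightarrow> 4 * s * (d * (s + e) powr (- d - 1)) + 4 * d * - ((s + e) powr (- d))
       = - 4 * d * e * (s + e) powr (- d - 1)"
proof -
  show "((\<lambda>s. - ((s + e) powr (- d))) has_real_derivative d * (s + e) powr (- d - 1)) (at s)" if "0 \<le> s"
    using that e by (auto intro!: derivative_eq_intros)
  show "continuous_on {0..} (\<lambda>s. d * (s + e) powr (- d - 1))"
    using e by (auto intro!: continuous_intros)
  assume s: "0 \<le> s"
  have "(s + e) powr (- d) = (s + e) * (s + e) powr (- d - 1)"
    using s e powr_add[of "s + e" 1 "- d - 1"] by simp
  then show "4 * s * (d * (s + e) powr (- d - 1)) + 4 * d * - ((s + e) powr (- d))
       = - 4 * d * e * (s + e) powr (- d - 1)"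
    by (simp only:) (simp add: algebra_simps)
qed

lemma newton_kernel_upper_bound:
  fixes K :: "real \<Rightarrow> real"
  assumes e: "0 < e" and d: "0 \<le> d" and K: "\<And>s. 0 \<le> s \<Longrightarrow> (K has_real_derivative (s + e) powr (- d)) (at s)"
    and s: "0 < \<sigma>" "\<sigma> \<le> s" and S: "0 \<le> S"
  shows "K S - K s \<le> S * \<sigma> powr (- d)"
proof (cases "s < S")
  case True
  obtain t where t: "s < t" "t < S" "K S - K s = (S - s) * (t + e) powr (- d)"
    using MVT2[OF True, of K "\<lambda>t. (t + e) powr (- d)"] K s by auto
  have "(t + e) powr (- d) \<le> \<sigma> powr (- d)"
    using t s e d by (intro powr_mono2') auto
  then show ?thesis
    unfolding t(3) using t s by (intro mult_mono) auto
next
  case False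
  have "K S \<le> K s"
  proof (rule DERIV_nonneg_imp_nondecreasing[where f = K and a = S and b = s])
    fix x assume "S \<le> x"
    then show "\<exists>y. (K has_real_derivative y) (at x) \<and> 0 \<le> y"
      using K[of x] S by (intro exI[of _ "(x + e) powr (- d)"]) auto
  qed (use False in simp)
  then show ?thesis using S by (smt (verit) mult_nonneg_nonneg powr_ge_zero)
qed

text \<open>
  A compactly supported minorant \<open>k\<close>, on \<open>{0..S}\<close>, of the smoothed Newtonian kernel \<open>K S - K s\<close>, obtained by
  multiplying its derivative by the cut-off \<open>(1 - (s / \<sigma>)\<^sup>d)\<^sup>2\<close>, continued by zero beyond \<open>\<sigma>\<close>. The
  Laplacian of the minorant is bounded above independently of \<open>e\<close> and is very negative near the centre, of the
  order \<open>- e powr (- d / 2)\<close>. The bound independent of \<open>e\<close> is the reason for the exponent \<open>d\<close> in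
  the cut-off: in the Laplacian of \<open>k\<close> the derivative of the cut-off comes with a factor \<open>s\<^sup>d\<close>, which
  absorbs the singularity \<open>s powr (- d / 2)\<close> of the derivative of the kernel.
\<close>

lemma truncated_kernel_exists:
  fixes K :: "real \<Rightarrow> real" and d :: nat and e \<sigma> :: real
  defines "b \<equiv> real d / 2"
  assumes d: "0 < d" and e: "0 < e" "e \<le> \<sigma> / 4" and S: "\<sigma> \<le> S"
    and K: "\<And>s. 0 \<le> s \<Longrightarrow> (K has_real_derivative (s + e) powr (- b)) (at s)"
  obtains k k1 k2 where
    "\<And>s. 0 \<le> s \<Longrightarrow> (k has_real_derivative k1 s) (at s)"
    "\<And>s. 0 \<le> s \<Longrightarrow> (k1 has_real_derivative k2 s) (at s)"
    "continuous_on {0..} k2"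
    "\<And>s. \<sigma> \<le> s \<Longrightarrow> k s = 0"
    "\<And>s. 0 \<le> s \<Longrightarrow> 0 \<le> k s"
    "\<And>s. 0 \<le> s \<Longrightarrow> s \<le> S \<Longrightarrow> k s \<le> K S - K s"
    "\<And>s. 0 \<le> s \<Longrightarrow> 4 * s * k2 s + 2 * real d * k1 s \<le> 8 * real d * \<sigma> powr (- b)"
    "\<And>s. 0 \<le> s \<Longrightarrow> s \<le> e \<Longrightarrow>
       4 * s * k2 s + 2 * real d * k1 s \<le> 8 * real d * \<sigma> powr (- b) - b * (2 * e) powr (- b)"
proof -
  have sg: "0 < \<sigma>" using e by simp
  have b0: "0 < b" using d by (simp add: b_def)
  define p where "p s = max 0 (1 - (s / \<sigma>) ^ d)" for s
  define w where "w s = (p s)\<^sup>2" for s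
  define w1 where "w1 s = 2 * p s * - (real d * (s / \<sigma>) ^ (d - 1) / \<sigma>)" for s
  define f where "f s = (s + e) powr (- b)" for s
  define f1 where "f1 s = - b * (s + e) powr (- b - 1)" for s
  have p01: "0 \<le> p s" "0 \<le> s \<Longrightarrow> p s \<le> 1" for s
    using sg by (auto simp: p_def)
  have p0: "p s = 0" if "\<sigma> \<le> s" for s
    using that sg one_le_power[of "s / \<sigma>" d] by (simp add: p_def)
  have contp: "continuous_on A p" for A
    unfolding p_def using sg by (intro continuous_intros) auto
  have contw: "continuous_on A w" "continuous_on A w1" for A
    unfolding w_def w1_def using sg by (auto intro!: continuous_intros contp)
  have contf: "continuous_on {-(e/2)..} f" "continuous_on {0..} f1"
    unfolding f_def f1_def using e by (auto intro!: continuous_intros)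
  have dw: "(w has_real_derivative w1 s) (at s)" for s
  proof -
    have "((\<lambda>s. 1 - (s / \<sigma>) ^ d) has_real_derivative - (real d * (s / \<sigma>) ^ (d - 1) / \<sigma>)) (at s)"
      using sg by (auto intro!: derivative_eq_intros)
    from DERIV_chain2[OF DERIV_positive_part_power[of 0] this]
    show ?thesis by (simp add: w_def[abs_def] w1_def p_def power2_eq_square mult_ac)
  qed
  have df: "(f has_real_derivative f1 s) (at s)" if "0 \<le> s" for s
    unfolding f_def f1_def using that e by (auto intro!: derivative_eq_intros)
  obtain Q where Q: "\<And>s. 0 \<le> s \<Longrightarrow> (Q has_real_derivative w s * f s) (at s)"
    using antiderivative_right_half_line[of "e / 2" "\<lambda>s. w s * f s"] e contw(1) contf(1)
    by (auto intro!: continuous_intros)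
  define k where "k s = Q \<sigma> - Q s" for s
  define k1 where "k1 s = - (w s * f s)" for s
  define k2 where "k2 s = - (w1 s * f s + f1 s * w s)" for s
  have f0: "0 < f s" if "0 \<le> s" for s using that e by (simp add: f_def)
  have w01: "0 \<le> w s" "0 \<le> s \<Longrightarrow> w s \<le> 1" for s
    using p01[of s] by (auto simp: w_def power_le_one)
  have dk: "(k has_real_derivative k1 s) (at s)" if "0 \<le> s" for s
    unfolding k_def k1_def using Q[OF that] by (auto intro!: derivative_eq_intros)
  have dk1: "(k1 has_real_derivative k2 s) (at s)" if "0 \<le> s" for s
    unfolding k1_def k2_def by (intro DERIV_minus DERIV_mult dw df that)
  have ck2: "continuous_on {0..} k2"
    unfolding k2_def
    by (intro continuous_intros contw contf continuous_on_subset[OF contf(1)]) (use e in auto)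
  have k0: "k s = 0" if s: "\<sigma> \<le> s" for s
  proof (cases "\<sigma> < s")
    case True
    obtain t where t: "\<sigma> < t" "t < s" "Q s - Q \<sigma> = (s - \<sigma>) * (w t * f t)"
      using MVT2[OF True, of Q "\<lambda>t. w t * f t"] Q sg by auto
    then show ?thesis using p0[of t] by (simp add: w_def k_def)
  qed (use s in \<open>simp add: k_def\<close>)
  have kpos: "0 \<le> k s" if s: "0 \<le> s" for s
  proof (cases "s < \<sigma>")
    case True
    obtain t where t: "s < t" "t < \<sigma>" "Q \<sigma> - Q s = (\<sigma> - s) * (w t * f t)"
      using MVT2[OF True, of Q "\<lambda>t. w t * f t"] Q s by auto
    then show ?thesis using s w01(1)[of t] f0[of t] by (simp add: k_def)
  qed (use k0 in simp)
  have kK: "k s \<le> K S - K s" if s: "0 \<le> s" "s \<le> S" for s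
  proof (cases "s < S")
    case True
    have dKQ: "((\<lambda>s. K s - Q s) has_real_derivative f t - w t * f t) (at t)" if "0 \<le> t" for t
      using K[OF that] Q[OF that] unfolding f_def by (intro DERIV_diff)
    obtain t where t: "s < t" "t < S" "(K S - Q S) - (K s - Q s) = (S - s) * (f t - w t * f t)"
      using MVT2[OF True, of "\<lambda>s. K s - Q s" "\<lambda>t. f t - w t * f t"] dKQ s by auto
    have "w t * f t \<le> 1 * f t"
      using w01(2)[of t] f0[of t] t s by (intro mult_right_mono) auto
    then have "0 \<le> (S - s) * (f t - w t * f t)" using t by simp
    then show ?thesis using t(3) k0[OF S] by (simp add: k_def)
  next
    case False
    then have "s = S" using s by simp
    then show ?thesis using k0[OF S] by simp
  qed
  have dual: "4 * s * k2 s + 2 * real d * k1 s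
      = 8 * real d * (p s * ((s / \<sigma>) ^ d * f s)) - 4 * b * e * w s * (s + e) powr (- b - 1)" if s: "0 \<le> s" for s
  proof -
    have "f s = (s + e) * (s + e) powr (- b - 1)"
      using s e powr_add[of "s + e" 1 "- b - 1"] by (simp add: f_def)
    then have 1: "4 * s * - (f1 s * w s) - 2 * real d * (w s * f s) = - (4 * b * e * w s * (s + e) powr (- b - 1))"
      by (simp add: f1_def b_def algebra_simps)
    have 3: "s * ((s / \<sigma>) ^ (d - 1) / \<sigma>) = (s / \<sigma>) ^ d"
      using d by (cases d) auto
    have "4 * s * - (w1 s * f s) = 8 * real d * (p s * ((s * ((s / \<sigma>) ^ (d - 1) / \<sigma>)) * f s))"
      by (simp add: w1_def)
    then have 2: "4 * s * - (w1 s * f s) = 8 * real d * (p s * ((s / \<sigma>) ^ d * f s))"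
      unfolding 3 .
    show ?thesis using 1 2 by (simp add: k1_def k2_def algebra_simps)
  qed
  have bnd: "p s * ((s / \<sigma>) ^ d * f s) \<le> \<sigma> powr (- b)" if s: "0 \<le> s" for s
  proof (cases "s = 0 \<or> \<sigma> \<le> s")
    case True
    then show ?thesis using p0[of s] d by (auto simp: zero_power)
  next
    case False
    then have s: "0 < s" "s < \<sigma>" using s by auto
    have "(s / \<sigma>) ^ d = (s / \<sigma>) powr real d" using s sg by (simp add: powr_realpow)
    also have "\<dots> \<le> (s / \<sigma>) powr b" using s sg by (intro powr_mono') (auto simp: b_def)
    finally have 1: "(s / \<sigma>) ^ d \<le> (s / \<sigma>) powr b" .
    have 2: "f s \<le> s powr (- b)" unfolding f_def using s e b0 by (intro powr_mono2') auto
    have "(s / \<sigma>) ^ d * f s \<le> (s / \<sigma>) powr b * s powr (- b)"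
      using 1 2 f0[of s] s sg by (intro mult_mono) auto
    also have "\<dots> = \<sigma> powr (- b)"
      using s sg by (simp add: powr_divide powr_minus field_simps)
    finally have "(s / \<sigma>) ^ d * f s \<le> \<sigma> powr (- b)" .
    then have "p s * ((s / \<sigma>) ^ d * f s) \<le> 1 * \<sigma> powr (- b)"
      using p01[of s] s sg f0[of s] by (intro mult_mono) auto
    then show ?thesis by simp
  qed
  have lap1: "4 * s * k2 s + 2 * real d * k1 s \<le> 8 * real d * \<sigma> powr (- b)" if s: "0 \<le> s" for s
  proof -
    have "8 * real d * (p s * ((s / \<sigma>) ^ d * f s)) \<le> 8 * real d * \<sigma> powr (- b)"
      using bnd[OF s] by (intro mult_left_mono) auto
    moreover have "0 \<le> 4 * b * e * w s * (s + e) powr (- b - 1)"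
      using b0 e w01[of s] by simp
    ultimately show ?thesis unfolding dual[OF s] by linarith
  qed
  have lap2: "4 * s * k2 s + 2 * real d * k1 s \<le> 8 * real d * \<sigma> powr (- b) - b * (2 * e) powr (- b)"
    if s: "0 \<le> s" "s \<le> e" for s
  proof -
    have "8 * real d * (p s * ((s / \<sigma>) ^ d * f s)) \<le> 8 * real d * \<sigma> powr (- b)"
      using bnd[OF s(1)] by (intro mult_left_mono) auto
    moreover have "b * (2 * e) powr (- b) \<le> 4 * b * e * w s * (s + e) powr (- b - 1)"
    proof -
      have "(s / \<sigma>) ^ d \<le> (1 / 4) ^ d"
        using s e sg by (intro power_mono) (auto simp: field_simps)
      also have "\<dots> \<le> (1 / 4) ^ 1" using d by (intro power_decreasing) auto
      finally have "3 / 4 \<le> p s" by (simp add: p_def)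
      then have "(3 / 4)\<^sup>2 \<le> w s" unfolding w_def by (intro power_mono) auto
      then have w: "1 / 2 \<le> w s" by (simp add: power2_eq_square)
      have "(2 * e) powr (- b) = (2 * e) * (2 * e) powr (- b - 1)"
        using e powr_add[of "2 * e" 1 "- b - 1"] by simp
      then have "b * (2 * e) powr (- b) = 4 * b * e * (1 / 2) * (2 * e) powr (- b - 1)"
        by simp
      also have "\<dots> \<le> 4 * b * e * w s * (2 * e) powr (- b - 1)"
        using w b0 e by (intro mult_right_mono mult_left_mono) auto
      also have "\<dots> \<le> 4 * b * e * w s * (s + e) powr (- b - 1)"
        using w b0 e s by (intro mult_left_mono powr_mono2') auto
      finally show ?thesis .
    qed
    ultimately show ?thesis unfolding dual[OF s(1)] by linarith
  qed
  show thesis by (rule that[OF dk dk1 ck2 k0 kpos kK lap1 lap2])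
qed

text \<open>
  The third power is the smallest that gives a continuous second derivative. The Laplacian is bounded
  below because the contribution of the second derivative is nonnegative.
\<close>

lemma bump_derivatives:
  fixes \<tau> :: real and d :: nat
  assumes \<tau>: "0 < \<tau>"
  shows "((\<lambda>s. (max 0 (1 - s / \<tau>)) ^ 3) has_real_derivative - 3 * (max 0 (1 - s / \<tau>))\<^sup>2 / \<tau>) (at s)"
    and "((\<lambda>s. - 3 * (max 0 (1 - s / \<tau>))\<^sup>2 / \<tau>) has_real_derivative 6 * max 0 (1 - s / \<tau>) / \<tau>\<^sup>2) (at s)"
    and "continuous_on A (\<lambda>s. 6 * max 0 (1 - s / \<tau>) / \<tau>\<^sup>2)"
    and "0 \<le> s \<Longrightarrow> - (6 * real d / \<tau>) \<le> 4 * s * (6 * max 0 (1 - s / \<tau>) / \<tau>\<^sup>2) + 2 * real d * (- 3 * (max 0 (1 - s / \<tau>))\<^sup>2 / \<tau>)"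
proof -
  have l: "((\<lambda>s. 1 - s / \<tau>) has_real_derivative - 1 / \<tau>) (at s)"
    using \<tau> by (auto intro!: derivative_eq_intros)
  show "((\<lambda>s. (max 0 (1 - s / \<tau>)) ^ 3) has_real_derivative - 3 * (max 0 (1 - s / \<tau>))\<^sup>2 / \<tau>) (at s)"
    using DERIV_chain2[OF DERIV_positive_part_power[of 1] l] by (simp add: numeral_eq_Suc)
  show "((\<lambda>s. - 3 * (max 0 (1 - s / \<tau>))\<^sup>2 / \<tau>) has_real_derivative 6 * max 0 (1 - s / \<tau>) / \<tau>\<^sup>2) (at s)"
    using DERIV_cmult[OF DERIV_chain2[OF DERIV_positive_part_power[of 0] l], of "- 3 / \<tau>"]
    by (simp add: numeral_eq_Suc mult_ac)
  show "continuous_on A (\<lambda>s. 6 * max 0 (1 - s / \<tau>) / \<tau>\<^sup>2)"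
    using \<tau> by (intro continuous_intros) auto
  assume s: "0 \<le> s"
  have m: "0 \<le> max 0 (1 - s / \<tau>)" "max 0 (1 - s / \<tau>) \<le> 1" using s \<tau> by auto
  have "(max 0 (1 - s / \<tau>))\<^sup>2 \<le> 1" using m by (intro power_le_one)
  then have "6 * real d * (max 0 (1 - s / \<tau>))\<^sup>2 / \<tau> \<le> 6 * real d * 1 / \<tau>"
    using \<tau> by (intro divide_right_mono mult_left_mono) auto
  moreover have "0 \<le> 4 * s * (6 * max 0 (1 - s / \<tau>) / \<tau>\<^sup>2)" using s m by simp
  ultimately show "- (6 * real d / \<tau>) \<le> 4 * s * (6 * max 0 (1 - s / \<tau>) / \<tau>\<^sup>2) + 2 * real d * (- 3 * (max 0 (1 - s / \<tau>))\<^sup>2 / \<tau>)"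
    by simp
qed

section \<open>Self-adjointness of ball averaging\<close>

definition ball_mean :: "real \<Rightarrow> ('a::euclidean_space \<Rightarrow> real) \<Rightarrow> 'a \<Rightarrow> real" where
  "ball_mean r f x = (\<integral>z. f (x + r *\<^sub>R z) \<partial>unit_ball_measure)"

lemma unit_ball_measure_uminus:
  fixes f :: "'a::euclidean_space \<Rightarrow> real"
  assumes [measurable]: "f \<in> borel_measurable borel"
  shows "(\<integral>z. f (- z) \<partial>unit_ball_measure) = (\<integral>z. f z \<partial>unit_ball_measure)"
  by (subst (2) distr_uminus_unit_ball_measure[symmetric])
     (subst integral_distr, auto simp: measurable_cong_sets[OF sets_unit_ball_measure])

text \<open>
  Averaging over balls is convolution with an even function, hence self-adjoint. This is used to move
  the average from a rough function \<open>p\<close> to a smooth test function.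
\<close>

lemma ball_mean_symmetric:
  fixes f p :: "'a::euclidean_space \<Rightarrow> real"
  assumes [measurable]: "f \<in> borel_measurable borel" and bdd: "\<And>y. \<bar>f y\<bar> \<le> B"
    and p: "integrable lborel p"
  shows "integrable lborel (ball_mean r p)"
    and "integrable lborel (\<lambda>y. ball_mean r f y * p y)"
    and "(\<integral>y. f y * ball_mean r p y \<partial>lborel) = (\<integral>y. ball_mean r f y * p y \<partial>lborel)"
proof -
  interpret N: finite_measure "unit_ball_measure :: 'a measure" by (rule unit_ball_measure_finite)
  interpret P: pair_sigma_finite "unit_ball_measure :: 'a measure" "lborel :: 'a measure" ..
  have pm[measurable]: "p \<in> borel_measurable borel" using p by auto
  have sets2: "sets (unit_ball_measure \<Otimes>\<^sub>M lborel) = sets (borel \<Otimes>\<^sub>M (borel :: 'a measure) :: ('a \<times> 'a) measure)"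
    by (intro sets_pair_measure_cong) auto
  have int1: "integrable (unit_ball_measure \<Otimes>\<^sub>M lborel) (\<lambda>(z, y). h y * p (y + r *\<^sub>R z))"
    if [measurable]: "h \<in> borel_measurable borel" and hb: "\<And>y. \<bar>h y\<bar> \<le> B'" for h :: "'a \<Rightarrow> real" and B'
  proof (rule P.Fubini_integrable)
    show meas: "(\<lambda>(z, y). h y * p (y + r *\<^sub>R z)) \<in> borel_measurable (unit_ball_measure \<Otimes>\<^sub>M lborel)"
      unfolding measurable_cong_sets[OF sets2 refl] by measurable
    have i: "integrable lborel (\<lambda>y. h y * p (y + r *\<^sub>R z))" for z
      using hb lborel_integral_translate(1)[OF p, of "r *\<^sub>R z"]
      by (intro Bochner_Integration.integrable_bound[OF integrable_mult_right[OF lborel_integral_translate(1)[OF p, of "r *\<^sub>R z"], of B']])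
         (auto simp: abs_mult intro!: mult_right_mono order_trans[OF hb])
    then show "AE z in unit_ball_measure. integrable lborel (\<lambda>y. case (z, y) of (z, y) \<Rightarrow> h y * p (y + r *\<^sub>R z))"
      by simp
    show "integrable unit_ball_measure (\<lambda>z. \<integral>y. norm (case (z, y) of (z, y) \<Rightarrow> h y * p (y + r *\<^sub>R z)) \<partial>lborel)"
    proof (rule N.integrable_const_bound)
      show "(\<lambda>z. \<integral>y. norm (case (z, y) of (z, y) \<Rightarrow> h y * p (y + r *\<^sub>R z)) \<partial>lborel) \<in> borel_measurable unit_ball_measure"
        using meas by measurable
      have "(\<integral>y. \<bar>h y * p (y + r *\<^sub>R z)\<bar> \<partial>lborel) \<le> \<bar>B'\<bar> * (\<integral>y. \<bar>p y\<bar> \<partial>lborel)" for z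
      proof -
        have "(\<integral>y. \<bar>h y * p (y + r *\<^sub>R z)\<bar> \<partial>lborel) \<le> (\<integral>y. \<bar>B'\<bar> * \<bar>p (y + r *\<^sub>R z)\<bar> \<partial>lborel)"
        proof (rule Bochner_Integration.integral_mono)
          show "integrable lborel (\<lambda>y. \<bar>h y * p (y + r *\<^sub>R z)\<bar>)"
            by (rule integrable_abs[OF i])
          show "integrable lborel (\<lambda>y. \<bar>B'\<bar> * \<bar>p (y + r *\<^sub>R z)\<bar>)"
            by (rule integrable_mult_right[OF integrable_abs[OF lborel_integral_translate(1)[OF p]]])
        qed (auto simp: abs_mult intro!: mult_right_mono order_trans[OF hb])
        also have "\<dots> = \<bar>B'\<bar> * (\<integral>y. \<bar>p y\<bar> \<partial>lborel)"
          using lborel_integral_translate(2)[of "\<lambda>y. \<bar>p y\<bar>" "r *\<^sub>R z"] p by simp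
        finally show ?thesis .
      qed
      then show "AE z in unit_ball_measure. norm (\<integral>y. norm (case (z, y) of (z, y) \<Rightarrow> h y * p (y + r *\<^sub>R z)) \<partial>lborel)
          \<le> \<bar>B'\<bar> * (\<integral>y. \<bar>p y\<bar> \<partial>lborel)"
        by (simp add: integral_nonneg_AE)
    qed
  qed
  have "integrable lborel (\<lambda>y. \<integral>z. 1 * p (y + r *\<^sub>R z) \<partial>unit_ball_measure)"
    using P.integrable_snd[OF int1[of "\<lambda>_. 1" 1]] by simp
  then show "integrable lborel (ball_mean r p)"
    by (simp add: ball_mean_def[abs_def])
  have int2: "integrable (unit_ball_measure \<Otimes>\<^sub>M lborel) (\<lambda>(z, y). f (y - r *\<^sub>R z) * p y)"
  proof (rule P.Fubini_integrable)
    show meas: "(\<lambda>(z, y). f (y - r *\<^sub>R z) * p y) \<in> borel_measurable (unit_ball_measure \<Otimes>\<^sub>M lborel)"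
      unfolding measurable_cong_sets[OF sets2 refl] by measurable
    have i: "integrable lborel (\<lambda>y. f (y - r *\<^sub>R z) * p y)" for z
      by (intro Bochner_Integration.integrable_bound[OF integrable_mult_right[OF p, of B]])
         (auto simp: abs_mult intro!: mult_right_mono order_trans[OF bdd])
    then show "AE z in unit_ball_measure. integrable lborel (\<lambda>y. case (z, y) of (z, y) \<Rightarrow> f (y - r *\<^sub>R z) * p y)"
      by simp
    show "integrable unit_ball_measure (\<lambda>z. \<integral>y. norm (case (z, y) of (z, y) \<Rightarrow> f (y - r *\<^sub>R z) * p y) \<partial>lborel)"
    proof (rule N.integrable_const_bound)
      show "(\<lambda>z. \<integral>y. norm (case (z, y) of (z, y) \<Rightarrow> f (y - r *\<^sub>R z) * p y) \<partial>lborel) \<in> borel_measurable unit_ball_measure"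
        using meas by measurable
      have "(\<integral>y. \<bar>f (y - r *\<^sub>R z) * p y\<bar> \<partial>lborel) \<le> (\<integral>y. \<bar>B\<bar> * \<bar>p y\<bar> \<partial>lborel)" for z
      proof (rule Bochner_Integration.integral_mono)
        show "integrable lborel (\<lambda>y. \<bar>f (y - r *\<^sub>R z) * p y\<bar>)"
          by (rule integrable_abs[OF i])
        show "integrable lborel (\<lambda>y. \<bar>B\<bar> * \<bar>p y\<bar>)"
          by (rule integrable_mult_right[OF integrable_abs[OF p]])
      qed (auto simp: abs_mult intro!: mult_right_mono order_trans[OF bdd])
      then show "AE z in unit_ball_measure. norm (\<integral>y. norm (case (z, y) of (z, y) \<Rightarrow> f (y - r *\<^sub>R z) * p y) \<partial>lborel)
          \<le> (\<integral>y. \<bar>B\<bar> * \<bar>p y\<bar> \<partial>lborel)"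
        by (simp add: integral_nonneg_AE)
    qed
  qed
  have int1f: "integrable (unit_ball_measure \<Otimes>\<^sub>M lborel) (\<lambda>(z, y). f y * p (y + r *\<^sub>R z))"
    by (rule int1[OF _ bdd]) simp
  have shift: "(\<integral>y. f y * p (y + r *\<^sub>R z) \<partial>lborel) = (\<integral>y. f (y - r *\<^sub>R z) * p y \<partial>lborel)" for z
  proof -
    have "integrable lborel (\<lambda>y. f (y - r *\<^sub>R z) * p y)"
      by (intro Bochner_Integration.integrable_bound[OF integrable_mult_right[OF p, of B]])
         (auto simp: abs_mult intro!: mult_right_mono order_trans[OF bdd])
    from lborel_integral_translate(2)[OF this, of "r *\<^sub>R z"] show ?thesis by simp
  qed
  have mean: "(\<integral>z. f (y - r *\<^sub>R z) * p y \<partial>unit_ball_measure) = ball_mean r f y * p y" for y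
    using unit_ball_measure_uminus[of "\<lambda>z. f (y + r *\<^sub>R z)"]
    by (simp add: ball_mean_def)
  show "integrable lborel (\<lambda>y. ball_mean r f y * p y)"
    using P.integrable_snd[OF int2] unfolding mean[symmetric] by simp
  have "(\<integral>y. f y * ball_mean r p y \<partial>lborel) = (\<integral>y. \<integral>z. f y * p (y + r *\<^sub>R z) \<partial>unit_ball_measure \<partial>lborel)"
    by (simp add: ball_mean_def)
  also have "\<dots> = (\<integral>z. \<integral>y. f y * p (y + r *\<^sub>R z) \<partial>lborel \<partial>unit_ball_measure)"
    by (rule P.Fubini_integral[OF int1f])
  also have "\<dots> = (\<integral>z. \<integral>y. f (y - r *\<^sub>R z) * p y \<partial>lborel \<partial>unit_ball_measure)"
    by (simp only: shift)
  also have "\<dots> = (\<integral>y. \<integral>z. f (y - r *\<^sub>R z) * p y \<partial>unit_ball_measure \<partial>lborel)"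
    by (rule P.Fubini_integral[OF int2, symmetric])
  finally show "(\<integral>y. f y * ball_mean r p y \<partial>lborel) = (\<integral>y. ball_mean r f y * p y \<partial>lborel)"
    by (simp only: mean)
qed

lemma radial_ball_mean_le:
  fixes a y :: "'a::euclidean_space" and h h1 h2 :: "real \<Rightarrow> real"
  assumes h: "\<And>s. 0 \<le> s \<Longrightarrow> (h has_real_derivative h1 s) (at s)"
    and h1: "\<And>s. 0 \<le> s \<Longrightarrow> (h1 has_real_derivative h2 s) (at s)"
    and h2: "continuous_on {0..} h2"
    and r: "0 \<le> r"
    and lap: "\<And>s. \<lbrakk>0 \<le> s; sqrt s \<le> dist y a + r\<rbrakk> \<Longrightarrow> 4 * s * h2 s + 2 * real DIM('a) * h1 s \<le> m"
  shows "ball_mean r (\<lambda>y. h ((y - a) \<bullet> (y - a))) y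
    \<le> h ((y - a) \<bullet> (y - a)) + ball_mean_constant TYPE('a) * m * r\<^sup>2"
proof -
  have "- h ((y - a) \<bullet> (y - a)) + ball_mean_constant TYPE('a) * (- m) * r\<^sup>2
    \<le> (\<integral>z. - h ((y - a + r *\<^sub>R z) \<bullet> (y - a + r *\<^sub>R z)) \<partial>unit_ball_measure)"
  proof (rule radial_ball_mean_ge[of "\<lambda>s. - h s" "\<lambda>s. - h1 s" "\<lambda>s. - h2 s" r "y - a" "- m"])
    fix z assume "z \<in> cball (y - a) r"
    then have "norm z \<le> norm (y - a) + r"
      using norm_triangle_sub[of z "y - a"] by (simp add: dist_norm norm_minus_commute)
    then have "sqrt (z \<bullet> z) \<le> dist y a + r" by (simp add: dist_norm norm_eq_sqrt_inner)
    from lap[OF _ this] show "- m \<le> 4 * (z \<bullet> z) * - h2 (z \<bullet> z) + 2 * real DIM('a) * - h1 (z \<bullet> z)"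
      by simp
  qed (use h h1 h2 r in \<open>auto intro!: DERIV_minus continuous_intros\<close>)
  then show ?thesis
    by (simp add: ball_mean_def algebra_simps)
qed


section \<open>Singularities of subharmonic functions\<close>

lemma subharmonic_bounded_above_on_compact:
  fixes u :: "'a::euclidean_space \<Rightarrow> ereal"
  assumes u: "subharmonic_on UNIV u" and K: "compact K"
  shows "\<exists>C\<ge>0. \<forall>y\<in>K. u y < ereal C"
proof -
  have op: "open {y. u y < c}" for c
    using u by (auto simp: subharmonic_on_def)
  have "K \<subseteq> (\<Union>n::nat. {y. u y < ereal (real n)})"
  proof
    fix y
    have "u y < \<infinity>" using u by (auto simp: subharmonic_on_def)
    then have "\<exists>n::nat. u y < ereal (real n)"
      using less_PInf_Ex_of_nat[of "u y"] by auto
    then show "y \<in> (\<Union>n::nat. {y. u y < ereal (real n)})" by auto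
  qed
  then obtain F :: "nat set" where F: "finite F" "K \<subseteq> (\<Union>n\<in>F. {y. u y < ereal (real n)})"
    using compactE_image[OF K, of UNIV "\<lambda>n::nat. {y. u y < ereal (real n)}"] op by metis
  have "u y < ereal (real (Max (insert 0 F)))" if y: "y \<in> K" for y
  proof -
    obtain n where n: "n \<in> F" "u y < ereal (real n)" using F(2) y by auto
    then have "ereal (real n) \<le> ereal (real (Max (insert 0 F)))" using F(1) by simp
    then show ?thesis using n(2) by (rule less_le_trans[rotated])
  qed
  then show ?thesis by (intro exI[of _ "real (Max (insert 0 F))"]) auto
qed

lemma subharmonic_measurable:
  fixes u :: "'a::euclidean_space \<Rightarrow> ereal"
  assumes u: "subharmonic_on UNIV u"
  shows "u \<in> borel_measurable borel"
proof (rule borel_measurableI_less)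
  fix c
  have "open {y. u y < c}" using u by (auto simp: subharmonic_on_def)
  then show "{x \<in> space borel. u x < c} \<in> sets borel" by simp
qed

text \<open>
  The sub-mean value inequality at a single point where \<open>u\<close> is finite bounds the integral over a
  ball of arbitrary size around that point.
\<close>

lemma subharmonic_locally_integrable:
  fixes u :: "'a::euclidean_space \<Rightarrow> ereal"
  assumes u: "subharmonic_on UNIV u" and x0: "u x0 \<noteq> - \<infinity>" and r: "0 < r"
  shows "(\<integral>\<^sup>+y. e2ennreal (- u y) * indicator (cball x0 r) y \<partial>lborel) < \<infinity>"
proof -
  note [measurable] = subharmonic_measurable[OF u]
  obtain C where C: "0 \<le> C" "\<And>y. y \<in> cball x0 r \<Longrightarrow> u y < ereal C"
    using subharmonic_bounded_above_on_compact[OF u compact_cball] by blast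
  let ?M = "uniform_measure lborel (cball x0 r)"
  define A where "A = (\<integral>\<^sup>+y. e2ennreal (u y) \<partial>?M)"
  define B where "B = (\<integral>\<^sup>+y. e2ennreal (- u y) \<partial>?M)"
  have vol: "emeasure lborel (cball x0 r) \<noteq> 0" "emeasure lborel (cball x0 r) \<noteq> \<infinity>"
    using emeasure_lborel_cball_finite[of x0 r] content_cball_pos[OF r, of x0] by (auto simp: measure_def)
  have total: "emeasure ?M UNIV = 1"
    using vol by (subst emeasure_uniform_measure) (auto simp: top.not_eq_extremum)
  have AEb: "AE y in ?M. y \<in> cball x0 r"
    by (rule AE_uniform_measureI) auto
  have "A \<le> (\<integral>\<^sup>+y. ennreal C \<partial>?M)"
    unfolding A_def
  proof (rule nn_integral_mono_AE)
    show "AE y in ?M. e2ennreal (u y) \<le> ennreal C"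
      using AEb
    proof eventually_elim
      case (elim y)
      from C(2)[OF this] have "u y \<le> ereal C" by simp
      from e2ennreal_mono[OF this] show ?case by simp
    qed
  qed
  also have "\<dots> = ennreal C"
    using total by simp
  finally have A: "A \<noteq> \<infinity>" by (auto simp: top_unique)
  have "u x0 \<le> enn2ereal A - enn2ereal B"
    using u r unfolding subharmonic_on_def ereal_integral_def A_def B_def by auto
  then have B: "B \<noteq> \<infinity>"
    using x0 A by (cases A; cases B) auto
  have "B = (\<integral>\<^sup>+y. e2ennreal (- u y) * indicator (cball x0 r) y \<partial>lborel) / emeasure lborel (cball x0 r)"
    unfolding B_def by (subst nn_integral_uniform_measure) auto
  with B vol show ?thesis
    by (auto simp: ennreal_divide_eq_top_iff top.not_eq_extremum)
qed

lemma integrable_uniform_measure_cball: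
  fixes p :: "'a::euclidean_space \<Rightarrow> real"
  assumes p: "integrable lborel p" and r: "0 < r"
  shows "integrable (uniform_measure lborel (cball x r)) p"
proof -
  have pm[measurable]: "p \<in> borel_measurable borel" using p by auto
  have vol: "emeasure lborel (cball x r) \<noteq> 0" "emeasure lborel (cball x r) \<noteq> \<infinity>"
    using emeasure_lborel_cball_finite[of x r] content_cball_pos[OF r, of x] by (auto simp: measure_def)
  have "(\<integral>\<^sup>+y. ennreal (norm (p y)) * indicator (cball x r) y \<partial>lborel) \<le> (\<integral>\<^sup>+y. ennreal (norm (p y)) \<partial>lborel)"
    by (intro nn_integral_mono) (auto simp: indicator_def)
  also have "\<dots> < \<infinity>" using p by (simp add: integrable_iff_bounded)
  finally have "(\<integral>\<^sup>+y. ennreal (norm (p y)) \<partial>uniform_measure lborel (cball x r)) < \<infinity>"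
    using vol by (subst nn_integral_uniform_measure) (auto simp: less_top[symmetric] ennreal_divide_eq_top_iff)
  then show ?thesis by (simp add: integrable_iff_bounded)
qed

text \<open>
  All that is needed of a subharmonic function \<open>u\<close>, rephrased for a nonnegative integrable real function:
  \<open>p\<close> is \<open>C - u\<close> on a ball, where \<open>C\<close> bounds \<open>u\<close> from above, and zero outside. The sub-mean value inequality becomes
  the statement that averaging decreases \<open>p\<close>, and upper semicontinuity makes \<open>p\<close> tend to infinity
  at each point where \<open>u\<close> is \<open>- \<infinity>\<close>. On the null set \<open>u = - \<infinity>\<close> itself \<open>p\<close> takes
  the meaningless value \<open>C\<close>, whence the qualifications "almost everywhere".
\<close>

lemma polar_function_density:
  fixes u :: "'a::euclidean_space \<Rightarrow> ereal"
  assumes u: "subharmonic_on UNIV u" and x0: "u x0 \<noteq> - \<infinity>" and R: "0 < R"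
  obtains p :: "'a \<Rightarrow> real" where
    "integrable lborel p" "\<And>y. 0 \<le> p y"
    "\<And>r. 0 < r \<Longrightarrow> AE y in lborel. cball y r \<subseteq> cball a R \<longrightarrow> ball_mean r p y \<le> p y"
    "\<And>x M. \<lbrakk>x \<in> ball a R; u x = - \<infinity>\<rbrakk> \<Longrightarrow> \<exists>\<eta>>0. AE y in lborel. y \<in> ball x \<eta> \<longrightarrow> M \<le> p y"
proof -
  note um[measurable] = subharmonic_measurable[OF u]
  define K where "K = cball x0 (dist a x0 + R)"
  have R': "0 < dist a x0 + R" using R by (simp add: add_nonneg_pos)
  have subK: "cball a R \<subseteq> K"
    unfolding K_def by (simp add: cball_subset_cball_iff)
  have Kc: "compact K" by (simp add: K_def)
  have Km[measurable]: "K \<in> sets borel" by (simp add: K_def)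
  obtain C where C: "0 \<le> C" "\<And>y. y \<in> K \<Longrightarrow> u y < ereal C"
    using subharmonic_bounded_above_on_compact[OF u Kc] by blast
  have fin: "(\<integral>\<^sup>+y. e2ennreal (- u y) * indicator K y \<partial>lborel) < \<infinity>"
    unfolding K_def by (rule subharmonic_locally_integrable[OF u x0 R'])
  have "AE y in lborel. e2ennreal (- u y) * indicator K y \<noteq> \<infinity>"
    using fin by (intro nn_integral_noteq_infinite) auto
  then have AEu: "AE y in lborel. y \<in> K \<longrightarrow> u y \<noteq> - \<infinity>"
    by eventually_elim (auto simp: e2ennreal_infty split: split_indicator)
  define p where "p y = (if y \<in> cball a R then C - real_of_ereal (u y) else 0)" for y
  have pm[measurable]: "p \<in> borel_measurable borel"
  proof -
    have [measurable]: "cball a R \<in> sets borel" by simp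
    show ?thesis unfolding p_def by measurable
  qed
  have p0: "0 \<le> p y" for y
  proof (cases "y \<in> cball a R")
    case True
    then have "u y < ereal C" using C(2) subK by auto
    then show ?thesis using C(1) by (cases "u y") (auto simp: p_def)
  qed (simp add: p_def)
  have intp: "integrable lborel p"
  proof (rule integrableI_nonneg)
    have "(\<integral>\<^sup>+y. ennreal (p y) \<partial>lborel)
        \<le> (\<integral>\<^sup>+y. ennreal C * indicator K y + e2ennreal (- u y) * indicator K y \<partial>lborel)"
    proof (rule nn_integral_mono)
      fix y
      show "ennreal (p y) \<le> ennreal C * indicator K y + e2ennreal (- u y) * indicator K y"
      proof (cases "y \<in> cball a R")
        case True
        then have yK: "y \<in> K" using subK by auto
        have "ennreal (C - real_of_ereal (u y)) \<le> ennreal C + e2ennreal (- u y)"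
        proof (cases "u y")
          case (real t)
          have "ennreal (C - t) \<le> ennreal (C + max 0 (- t))" by (intro ennreal_leI) auto
          also have "\<dots> = ennreal C + ennreal (- t)"
          proof -
            have "ennreal (C + max 0 (- t)) = ennreal C + ennreal (max 0 (- t))"
              using C(1) by (intro ennreal_plus) auto
            also have "ennreal (max 0 (- t)) = ennreal (- t)" by (auto simp: max_def ennreal_neg)
            finally show ?thesis .
          qed
          finally show ?thesis using real by simp
        next
          case PInf
          then show ?thesis using C(2)[OF yK] by simp
        next
          case MInf
          then show ?thesis by simp
        qed
        then show ?thesis using True yK by (simp add: p_def)
      qed (simp add: p_def)
    qed
    also have "\<dots> = ennreal C * emeasure lborel K + (\<integral>\<^sup>+y. e2ennreal (- u y) * indicator K y \<partial>lborel)"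
      by (subst nn_integral_add) (auto simp: nn_integral_cmult_indicator)
    also have "\<dots> < \<infinity>"
      using fin emeasure_lborel_cball_finite[of x0 "dist a x0 + R"]
      by (simp add: K_def ennreal_mult_less_top)
    finally show "(\<integral>\<^sup>+y. ennreal (p y) \<partial>lborel) < \<infinity>" .
  qed (use p0 in auto)
  have sub: "AE y in lborel. cball y r \<subseteq> cball a R \<longrightarrow> ball_mean r p y \<le> p y" if r: "0 < r" for r
    using AEu
  proof eventually_elim
    case (elim y)
    show ?case
    proof
      assume sub: "cball y r \<subseteq> cball a R"
      let ?M = "uniform_measure lborel (cball y r)"
      have y: "y \<in> cball a R" using subsetD[OF sub, of y] r by simp
      then have uy: "u y \<noteq> - \<infinity>" using elim subK by auto
      have uy2: "u y < ereal C" using C(2) subK y by auto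
      have intM: "integrable ?M p" by (rule integrable_uniform_measure_cball[OF intp r])
      have AEM: "AE x in ?M. u x = ereal (C - p x)"
      proof (rule AE_uniform_measureI)
        show "AE x in lborel. x \<in> cball y r \<longrightarrow> u x = ereal (C - p x)"
          using AEu
        proof eventually_elim
          case (elim x)
          show ?case
          proof
            assume "x \<in> cball y r"
            then have x: "x \<in> cball a R" using sub by blast
            then have xK: "x \<in> K" using subK by blast
            have "u x < ereal C" "u x \<noteq> - \<infinity>" using C(2)[OF xK] elim xK by auto
            then show "u x = ereal (C - p x)"
              using x by (cases "u x") (auto simp: p_def)
          qed
        qed
      qed simp
      have vol: "emeasure lborel (cball y r) \<noteq> 0" "emeasure lborel (cball y r) \<noteq> \<infinity>"
        using emeasure_lborel_cball_finite[of y r] content_cball_pos[OF r, of y] by (auto simp: measure_def)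
      have total: "emeasure ?M UNIV = 1"
        using vol by (subst emeasure_uniform_measure) (auto simp: top.not_eq_extremum)
      then interpret M: finite_measure ?M by (intro finite_measureI) simp
      have "u y \<le> ereal_integral ?M u"
        using u r by (auto simp: subharmonic_on_def)
      also have "ereal_integral ?M u = ereal_integral ?M (\<lambda>x. ereal (C - p x))"
        unfolding ereal_integral_def
        using AEM by (intro arg_cong2[where f = minus] arg_cong[where f = enn2ereal] nn_integral_cong_AE) auto
      also have "\<dots> = ereal (\<integral>x. C - p x \<partial>?M)"
        using intM by (intro ereal_integral_eq_lebesgue_integral) auto
      also have "(\<integral>x. C - p x \<partial>?M) = C - (\<integral>x. p x \<partial>?M)"
        using intM total by (simp add: measure_def)
      also have "(\<integral>x. p x \<partial>?M) = ball_mean r p y"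
        unfolding ball_mean_def using r by (rule integral_uniform_measure_cball) simp
      finally show "ball_mean r p y \<le> p y"
        using uy uy2 y by (cases "u y") (auto simp: p_def)
    qed
  qed
  have sing: "\<exists>\<eta>>0. AE y in lborel. y \<in> ball x \<eta> \<longrightarrow> M \<le> p y" if x: "x \<in> ball a R" "u x = - \<infinity>" for x M
  proof -
    have "open ({y. u y < ereal (C - M)} \<inter> ball a R)"
      using u by (intro open_Int) (auto simp: subharmonic_on_def)
    moreover have "x \<in> {y. u y < ereal (C - M)} \<inter> ball a R" using x by auto
    ultimately obtain \<eta> where \<eta>: "0 < \<eta>" "ball x \<eta> \<subseteq> {y. u y < ereal (C - M)} \<inter> ball a R"
      by (meson openE)
    have "AE y in lborel. y \<in> ball x \<eta> \<longrightarrow> M \<le> p y"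
      using AEu
    proof eventually_elim
      case (elim y)
      show ?case
      proof
        assume "y \<in> ball x \<eta>"
        then have y: "u y < ereal (C - M)" "y \<in> ball a R" using \<eta>(2) by auto
        then have "y \<in> cball a R" by auto
        then have "u y \<noteq> - \<infinity>" using elim subK by auto
        then show "M \<le> p y" using y \<open>y \<in> cball a R\<close> by (cases "u y") (auto simp: p_def)
      qed
    qed
    then show ?thesis using \<eta>(1) by blast
  qed
  show thesis by (rule that[OF intp p0 sub sing])
qed

section \<open>Localizing the potential of a subharmonic function\<close>

text \<open>
  The defect \<open>p - ball_mean r p\<close>, divided by \<open>r\<^sup>2\<close>, plays the role of the Riesz measure of \<open>u = C - p\<close>,
  up to a constant factor, and the identity that of Green's formula.
\<close>

lemma integral_bounded_times_defect:
  fixes f p :: "'a::euclidean_space \<Rightarrow> real"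
  assumes f[measurable]: "f \<in> borel_measurable borel" and bdd: "\<And>y. \<bar>f y\<bar> \<le> B"
    and p: "integrable lborel p"
  shows "integrable lborel (\<lambda>y. f y * (p y - ball_mean r p y))"
    and "integrable lborel (\<lambda>y. (f y - ball_mean r f y) * p y)"
    and "(\<integral>y. f y * (p y - ball_mean r p y) \<partial>lborel) = (\<integral>y. (f y - ball_mean r f y) * p y \<partial>lborel)"
proof -
  note sym = ball_mean_symmetric[OF f bdd p, of r]
  have mult: "integrable lborel (\<lambda>y. f y * q y)" if q: "integrable lborel q" for q :: "'a \<Rightarrow> real"
    using q by (intro Bochner_Integration.integrable_bound[OF integrable_mult_right[OF q, of B]])
      (auto simp: abs_mult intro!: mult_right_mono order_trans[OF bdd])
  show "integrable lborel (\<lambda>y. f y * (p y - ball_mean r p y))"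
    by (intro mult Bochner_Integration.integrable_diff p sym(1))
  show "integrable lborel (\<lambda>y. (f y - ball_mean r f y) * p y)"
    using Bochner_Integration.integrable_diff[OF mult[OF p] sym(2)] by (simp add: left_diff_distrib)
  show "(\<integral>y. f y * (p y - ball_mean r p y) \<partial>lborel) = (\<integral>y. (f y - ball_mean r f y) * p y \<partial>lborel)"
    using mult[OF p] mult[OF sym(1)] sym(2,3)
    by (simp add: left_diff_distrib right_diff_distrib)
qed

lemma inner_diff_swap: "(x - y) \<bullet> (x - y) = (y - x) \<bullet> (y - (x::'a::real_inner))"
  by (simp add: algebra_simps inner_commute)

lemma inner_diff_eq_dist: "(y - x) \<bullet> (y - x) = (dist y x)\<^sup>2"
  by (simp add: dist_norm dot_square_norm)

text \<open>
  The approximate Riesz masses of a ball stay bounded as \<open>r\<close> tends to zero: dominate the indicator of the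
  ball by eight times a bump function and move the averaging onto the bump, whose defect is of order \<open>r\<^sup>2\<close>.
\<close>

lemma bounded_mass_of_defect:
  fixes p :: "'a::euclidean_space \<Rightarrow> real"
  assumes \<rho>: "0 < \<rho>" and p: "integrable lborel p" "\<And>y. 0 \<le> p y" and r: "0 < r" "r \<le> \<rho>"
    and sub: "AE y in lborel. cball y r \<subseteq> cball a (4 * \<rho>) \<longrightarrow> ball_mean r p y \<le> p y"
  shows "(\<integral>y. indicator (ball a (2 * \<rho>)) y * max 0 ((p y - ball_mean r p y) / r\<^sup>2) \<partial>lborel)
    \<le> 8 * ball_mean_constant TYPE('a) * (6 * real DIM('a) / (9 * \<rho>\<^sup>2)) * (\<integral>y. p y \<partial>lborel)"
proof -
  let ?c = "ball_mean_constant TYPE('a)"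
  define \<tau> where "\<tau> = 9 * \<rho>\<^sup>2"
  have \<tau>: "0 < \<tau>" using \<rho> by (simp add: \<tau>_def)
  define h where "h s = max 0 (1 - s / \<tau>) ^ 3" for s :: real
  define f where "f y = h ((y - a) \<bullet> (y - a))" for y
  note bd = bump_derivatives[OF \<tau>]
  have contf: "continuous_on UNIV f"
    unfolding f_def h_def using \<tau> by (intro continuous_intros) auto
  have fm[measurable]: "f \<in> borel_measurable borel" using contf by (rule borel_measurable_continuous_onI)
  have f01: "0 \<le> f y" "f y \<le> 1" for y
    using \<tau> by (auto simp: f_def h_def intro!: power_le_one)
  have fb: "\<bar>f y\<bar> \<le> 1" for y using f01[of y] by simp
  have f_out: "f y = 0" if "y \<notin> ball a (3 * \<rho>)" for y
  proof -
    have "3 * \<rho> \<le> dist y a" using that by (simp add: dist_commute)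
    then have "(3 * \<rho>)\<^sup>2 \<le> (dist y a)\<^sup>2" using \<rho> by (intro power_mono) auto
    then have "1 \<le> (dist y a)\<^sup>2 / \<tau>" using \<tau> by (simp add: \<tau>_def power_mult_distrib)
    then show ?thesis by (simp add: f_def h_def inner_diff_eq_dist)
  qed
  have f_in: "1 \<le> 8 * f y" if "y \<in> ball a (2 * \<rho>)" for y
  proof -
    have "dist y a \<le> 2 * \<rho>" using that by (simp add: dist_commute)
    then have "(dist y a)\<^sup>2 \<le> (2 * \<rho>)\<^sup>2" using \<rho> by (intro power_mono) auto
    then have "2 * (dist y a)\<^sup>2 \<le> 8 * \<rho>\<^sup>2" by (simp add: power_mult_distrib)
    also have "\<dots> \<le> \<tau>" unfolding \<tau>_def by (intro mult_right_mono) auto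
    finally have "(dist y a)\<^sup>2 / \<tau> \<le> 1 / 2" using \<tau> by (simp add: field_simps)
    then have "1 / 2 \<le> 1 - (dist y a)\<^sup>2 / \<tau>" by linarith
    then have half: "1 / 2 \<le> max 0 (1 - (dist y a)\<^sup>2 / \<tau>)" by (rule max.coboundedI2)
    have "(1 / 2) ^ 3 \<le> f y" unfolding f_def h_def inner_diff_eq_dist by (rule power_mono[OF half]) simp
    then show ?thesis by (simp add: power3_eq_cube)
  qed
  have mean: "f y - ball_mean r f y \<le> ?c * (6 * real DIM('a) / \<tau>) * r\<^sup>2" for y
  proof -
    have "h ((y - a) \<bullet> (y - a)) + ?c * (- (6 * real DIM('a) / \<tau>)) * r\<^sup>2
      \<le> (\<integral>z. h ((y - a + r *\<^sub>R z) \<bullet> (y - a + r *\<^sub>R z)) \<partial>unit_ball_measure)"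
      unfolding h_def
      by (rule radial_ball_mean_ge[OF bd(1) bd(2) bd(3)]) (use r bd(4) in auto)
    then show ?thesis
      by (simp add: ball_mean_def f_def algebra_simps)
  qed
  let ?D = "\<lambda>y. p y - ball_mean r p y"
  have intD: "integrable lborel ?D"
    using integral_bounded_times_defect(1)[of "\<lambda>_. 1" 1 p r] p by simp
  have "(\<integral>y. indicator (ball a (2 * \<rho>)) y * max 0 (?D y / r\<^sup>2) \<partial>lborel) \<le> (\<integral>y. 8 / r\<^sup>2 * (f y * ?D y) \<partial>lborel)"
  proof (rule integral_mono_AE')
    show "integrable lborel (\<lambda>y. 8 / r\<^sup>2 * (f y * ?D y))"
      by (intro integrable_mult_right integral_bounded_times_defect(1)[OF fm fb p(1)])
    have pos: "AE y in lborel. 0 \<le> f y * ?D y \<and> (y \<in> ball a (2 * \<rho>) \<longrightarrow> 0 \<le> ?D y)"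
      using sub
    proof eventually_elim
      case (elim y)
      have "0 \<le> ?D y" if "y \<in> ball a (3 * \<rho>)"
      proof -
        have "cball y r \<subseteq> cball a (4 * \<rho>)"
          using that r \<rho> by (simp add: cball_subset_cball_iff dist_commute)
        then show ?thesis using elim by simp
      qed
      then show ?case
        using f_out[of y] f01[of y] \<rho> by (cases "y \<in> ball a (3 * \<rho>)") auto
    qed
    then show "AE y in lborel. 0 \<le> 8 / r\<^sup>2 * (f y * ?D y)"
      by eventually_elim (rule mult_nonneg_nonneg, simp, blast)
    show "AE y in lborel. indicator (ball a (2 * \<rho>)) y * max 0 (?D y / r\<^sup>2) \<le> 8 / r\<^sup>2 * (f y * ?D y)"
      using pos
    proof eventually_elim
      case (elim y)
      show ?case
      proof (cases "y \<in> ball a (2 * \<rho>)")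
        case True
        then have D: "0 \<le> ?D y" using elim by blast
        have "1 * (?D y / r\<^sup>2) \<le> (8 * f y) * (?D y / r\<^sup>2)"
          using D f_in[OF True] by (intro mult_right_mono) auto
        then show ?thesis using True D by (simp add: mult_ac)
      next
        case False
        then have ind0: "indicator (ball a (2 * \<rho>)) y = (0 :: real)" by simp
        have "0 \<le> 8 / r\<^sup>2 * (f y * ?D y)" by (rule mult_nonneg_nonneg) (simp, use elim in blast)
        then show ?thesis unfolding ind0 mult_zero_left .
      qed
    qed
  qed
  also have "\<dots> = 8 / r\<^sup>2 * (\<integral>y. (f y - ball_mean r f y) * p y \<partial>lborel)"
    using integral_bounded_times_defect(3)[OF fm fb p(1), of r] by simp
  also have "\<dots> \<le> 8 / r\<^sup>2 * (\<integral>y. (?c * (6 * real DIM('a) / \<tau>) * r\<^sup>2) * p y \<partial>lborel)"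
    using p mean
    by (intro mult_left_mono Bochner_Integration.integral_mono integral_bounded_times_defect(2)[OF fm fb p(1)] mult_right_mono) auto
  also have "\<dots> = 8 * ?c * (6 * real DIM('a) / \<tau>) * (\<integral>y. p y \<partial>lborel)"
    using r by simp
  finally show ?thesis by (simp only: \<tau>_def)
qed

text \<open>
  Here \<open>w\<close> is the potential, with respect to the smoothed Newtonian kernel, of the approximate Riesz
  measure \<open>(p - ball_mean r p) / r\<^sup>2\<close> restricted to \<open>ball a (2 * \<rho>)\<close>. The restriction keeps it
  bounded above, uniformly in \<open>r\<close>, away from that ball. Close to \<open>a\<close>, comparison with the truncated kernel and
  Green's formula show that \<open>w x\<close> is, up to a bounded error, at least a constant multiple of the
  average of \<open>p\<close> over \<open>ball x r\<close>, which tends to infinity as \<open>r\<close> tends to zero if \<open>x\<close> is a singularity.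
  The smoothing scale of the kernel is tied to \<open>r\<close> by \<open>sqrt e = 2 r\<close>: a ball of radius \<open>r\<close> centred in
  \<open>ball x r\<close> then lies in the region where the Laplacian of the truncated kernel is very negative.
\<close>

lemma swept_potential:
  fixes p :: "'a::euclidean_space \<Rightarrow> real"
  defines "b \<equiv> real DIM('a) / 2" and "c \<equiv> ball_mean_constant TYPE('a)"
  assumes \<rho>: "0 < \<rho>" and p: "integrable lborel p" "\<And>y. 0 \<le> p y" and r: "0 < r" "r \<le> \<rho> / 4"
    and sub: "AE y in lborel. cball y r \<subseteq> cball a (4 * \<rho>) \<longrightarrow> ball_mean r p y \<le> p y"
    and S: "9 * \<rho>\<^sup>2 \<le> S"
  obtains w :: "'a \<Rightarrow> real" where
    "continuous_on UNIV w" "\<And>U. subharmonic_on U (\<lambda>x. ereal (- w x))"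
    "\<And>x. (\<And>y. y \<in> ball a (2 * \<rho>) \<Longrightarrow> (dist x y)\<^sup>2 \<le> S) \<Longrightarrow> 0 \<le> w x"
    "\<And>x. x \<notin> ball a (3 * \<rho>) \<Longrightarrow>
      w x \<le> S * (\<rho>\<^sup>2) powr (- b) * (8 * c * (6 * real DIM('a) / (9 * \<rho>\<^sup>2)) * (\<integral>y. p y \<partial>lborel))"
    "\<And>x. x \<in> cball a \<rho> \<Longrightarrow>
      c * b * 8 powr (- b) * ((\<integral>y. indicator (ball x r) y * p y \<partial>lborel) / r ^ DIM('a))
        - c * (8 * real DIM('a) * (\<rho>\<^sup>2) powr (- b)) * (\<integral>y. p y \<partial>lborel) \<le> w x"
proof -
  let ?d = "DIM('a)"
  let ?B = "ball a (2 * \<rho>)"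
  define P where "P = (\<integral>y. p y \<partial>lborel)"
  define e where "e = 4 * r\<^sup>2"
  have c: "0 < c" unfolding c_def by (rule ball_mean_constant_pos)
  have b: "0 < b" by (simp add: b_def)
  have e: "0 < e" "e \<le> \<rho>\<^sup>2 / 4"
  proof -
    show "0 < e" using r by (simp add: e_def)
    have "r\<^sup>2 \<le> (\<rho> / 4)\<^sup>2" using r by (intro power_mono) auto
    then show "e \<le> \<rho>\<^sup>2 / 4" by (simp add: e_def power_divide)
  qed
  have S0: "0 \<le> S" "\<rho>\<^sup>2 \<le> S" using S zero_le_power2[of \<rho>] by linarith+
  obtain K where K: "\<And>s. 0 \<le> s \<Longrightarrow> (K has_real_derivative (s + e) powr (- b)) (at s)"
    using newton_kernel_exists[OF e(1), of b] by blast
  define \<kappa> where "\<kappa> s = K S - K s" for s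
  have d\<kappa>: "(\<kappa> has_real_derivative - ((s + e) powr (- b))) (at s)" if "0 \<le> s" for s
    unfolding \<kappa>_def using K[OF that] by (auto intro!: derivative_eq_intros)
  have cont\<kappa>: "continuous_on {0..} \<kappa>"
    by (rule DERIV_continuous_on, rule has_field_derivative_at_within, rule d\<kappa>) simp
  note nk = newton_kernel_derivatives[OF e(1), where d = b]
  obtain k k1 k2 where k:
    "\<And>s. 0 \<le> s \<Longrightarrow> (k has_real_derivative k1 s) (at s)"
    "\<And>s. 0 \<le> s \<Longrightarrow> (k1 has_real_derivative k2 s) (at s)"
    "continuous_on {0..} k2"
    "\<And>s. \<rho>\<^sup>2 \<le> s \<Longrightarrow> k s = 0"
    "\<And>s. 0 \<le> s \<Longrightarrow> 0 \<le> k s"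
    "\<And>s. 0 \<le> s \<Longrightarrow> s \<le> S \<Longrightarrow> k s \<le> K S - K s"
    "\<And>s. 0 \<le> s \<Longrightarrow> 4 * s * k2 s + 2 * real ?d * k1 s \<le> 8 * real ?d * (\<rho>\<^sup>2) powr (- b)"
    "\<And>s. 0 \<le> s \<Longrightarrow> s \<le> e \<Longrightarrow>
       4 * s * k2 s + 2 * real ?d * k1 s \<le> 8 * real ?d * (\<rho>\<^sup>2) powr (- b) - b * (2 * e) powr (- b)"
    using truncated_kernel_exists[OF DIM_positive e S0(2) K[unfolded b_def], folded b_def]
    by blast
  define D where "D y = p y - ball_mean r p y" for y
  have intD: "integrable lborel D"
    using integral_bounded_times_defect(1)[of "\<lambda>_. 1" 1 p r] p by (simp add: D_def[abs_def])
  have Dm[measurable]: "D \<in> borel_measurable borel" using intD by auto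
  \<comment> \<open>The truncation by \<open>max 0\<close> changes \<open>g\<close> on a null set only; it makes \<open>g\<close> a density.\<close>
  define g where "g y = indicator ?B y * max 0 (D y / r\<^sup>2)" for y
  have intg: "integrable lborel g"
    unfolding g_def
    using integrable_mult_indicator[of ?B lborel "\<lambda>y. max 0 (D y / r\<^sup>2)"] intD by auto
  have gm[measurable]: "g \<in> borel_measurable borel" using intg by auto
  have g0: "0 \<le> g y" for y by (simp add: g_def)
  have AEg: "AE y in lborel. y \<in> ?B \<longrightarrow> g y = D y / r\<^sup>2"
    using sub
  proof eventually_elim
    case (elim y)
    show ?case
    proof
      assume y: "y \<in> ?B"
      then have "cball y r \<subseteq> cball a (4 * \<rho>)"
        using r \<rho> by (simp add: cball_subset_cball_iff dist_commute)
      then have "0 \<le> D y" using elim by (simp add: D_def)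
      then show "g y = D y / r\<^sup>2" using y by (simp add: g_def)
    qed
  qed
  define \<gamma> where "\<gamma> = density lborel (\<lambda>y. ennreal (g y))"
  have sets\<gamma>: "sets \<gamma> = sets borel" by (simp add: \<gamma>_def)
  have fin\<gamma>: "finite_measure \<gamma>"
    unfolding \<gamma>_def using intg g0
    by (intro finite_measureI) (simp add: emeasure_density integrable_iff_bounded top.not_eq_extremum)
  have bdd\<gamma>: "AE y in \<gamma>. y \<in> ?B"
    unfolding \<gamma>_def by (subst AE_density) (auto simp: g_def indicator_def)
  have int\<gamma>: "(\<integral>y. \<phi> ((x - y) \<bullet> (x - y)) \<partial>\<gamma>) = (\<integral>y. g y * \<phi> ((y - x) \<bullet> (y - x)) \<partial>lborel)"
    "integrable lborel (\<lambda>y. g y * \<phi> ((y - x) \<bullet> (y - x)))"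
    if "continuous_on {0..} \<phi>" for \<phi> :: "real \<Rightarrow> real" and x
  proof -
    have "continuous_on UNIV (\<lambda>y. \<phi> ((y - x) \<bullet> (y - x)))"
      by (rule continuous_on_compose2[OF that]) (auto intro!: continuous_intros)
    then have [measurable]: "(\<lambda>y. \<phi> ((y - x) \<bullet> (y - x))) \<in> borel_measurable borel"
      by (rule borel_measurable_continuous_onI)
    show "(\<integral>y. \<phi> ((x - y) \<bullet> (x - y)) \<partial>\<gamma>) = (\<integral>y. g y * \<phi> ((y - x) \<bullet> (y - x)) \<partial>lborel)"
      unfolding \<gamma>_def inner_diff_swap[of x] using g0 by (subst integral_density) auto
    show "integrable lborel (\<lambda>y. g y * \<phi> ((y - x) \<bullet> (y - x)))"
      using radial_potential_integrable(1)[OF fin\<gamma> sets\<gamma> bdd\<gamma> that, of x]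
      unfolding \<gamma>_def inner_diff_swap[of x] using g0 by (subst (asm) integrable_density) auto
  qed
  define w where "w x = (\<integral>y. \<kappa> ((x - y) \<bullet> (x - y)) \<partial>\<gamma>)" for x
  have w: "w x = (\<integral>y. g y * \<kappa> ((y - x) \<bullet> (y - x)) \<partial>lborel)"
    "integrable lborel (\<lambda>y. g y * \<kappa> ((y - x) \<bullet> (y - x)))" for x
    unfolding w_def by (rule int\<gamma>[OF cont\<kappa>])+
  have contw: "continuous_on UNIV w"
    unfolding w_def by (rule radial_potential_integrable(2)[OF fin\<gamma> sets\<gamma> bdd\<gamma> cont\<kappa>])
  have subw: "subharmonic_on U (\<lambda>x. ereal (- w x))" for U
    unfolding w_def
  proof (rule radial_potential_subharmonic[OF fin\<gamma> sets\<gamma> bdd\<gamma> d\<kappa> nk(1) nk(2)])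
    fix s :: real assume s: "0 \<le> s"
    have "- 4 * b * e * (s + e) powr (- b - 1) \<le> 0" using b e by simp
    then show "4 * s * (b * (s + e) powr (- b - 1)) + 2 * real ?d * - ((s + e) powr (- b)) \<le> 0"
      using nk(3)[OF s] by (simp add: b_def)
  qed
  have \<kappa>0: "0 \<le> \<kappa> s" if "0 \<le> s" "s \<le> S" for s
    using k(5,6)[OF that(1)] that by (fastforce simp: \<kappa>_def)
  have near: "0 \<le> w x" if "\<And>y. y \<in> ?B \<Longrightarrow> (dist x y)\<^sup>2 \<le> S" for x
    unfolding w(1)
  proof (rule Bochner_Integration.integral_nonneg)
    fix y
    show "0 \<le> g y * \<kappa> ((y - x) \<bullet> (y - x))"
      using that[of y] \<kappa>0[of "(dist y x)\<^sup>2"] g0[of y]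
      by (cases "y \<in> ?B") (auto simp: g_def inner_diff_eq_dist dist_commute)
  qed
  have far: "w x \<le> S * (\<rho>\<^sup>2) powr (- b) * (8 * c * (6 * real ?d / (9 * \<rho>\<^sup>2)) * P)" if x: "x \<notin> ball a (3 * \<rho>)" for x
  proof -
    have "w x \<le> (\<integral>y. (S * (\<rho>\<^sup>2) powr (- b)) * g y \<partial>lborel)"
      unfolding w(1)
    proof (rule Bochner_Integration.integral_mono)
      fix y
      show "g y * \<kappa> ((y - x) \<bullet> (y - x)) \<le> S * (\<rho>\<^sup>2) powr (- b) * g y"
      proof (cases "y \<in> ?B")
        case True
        have "\<rho> \<le> dist y x" using True x dist_triangle[of a x y] by (simp add: dist_commute)
        then have "\<rho>\<^sup>2 \<le> (dist y x)\<^sup>2" using \<rho> by (intro power_mono) auto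
        then have "\<kappa> ((y - x) \<bullet> (y - x)) \<le> S * (\<rho>\<^sup>2) powr (- b)"
          unfolding \<kappa>_def inner_diff_eq_dist using \<rho> b S0
          by (intro newton_kernel_upper_bound[OF e(1) _ K]) auto
        from mult_left_mono[OF this g0[of y]] show ?thesis by (simp add: mult_ac)
      qed (simp add: g_def)
    qed (use intg w(2) in auto)
    also have "\<dots> = S * (\<rho>\<^sup>2) powr (- b) * (\<integral>y. g y \<partial>lborel)"
      by simp
    also have "\<dots> \<le> S * (\<rho>\<^sup>2) powr (- b) * (8 * c * (6 * real ?d / (9 * \<rho>\<^sup>2)) * P)"
      unfolding g_def D_def c_def P_def using r \<rho> S0
      by (intro mult_left_mono bounded_mass_of_defect p sub) auto
    finally show ?thesis .
  qed
  have deep: "c * b * 8 powr (- b) * ((\<integral>y. indicator (ball x r) y * p y \<partial>lborel) / r ^ ?d)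
        - c * (8 * real ?d * (\<rho>\<^sup>2) powr (- b)) * P \<le> w x" if x: "x \<in> cball a \<rho>" for x
  proof -
    define f where "f y = k ((y - x) \<bullet> (y - x))" for y
    have contk: "continuous_on {0..} k"
      by (rule DERIV_continuous_on, rule has_field_derivative_at_within, rule k(1)) simp
    have contf: "continuous_on UNIV f"
      unfolding f_def by (rule continuous_on_compose2[OF contk]) (auto intro!: continuous_intros)
    have fm[measurable]: "f \<in> borel_measurable borel" using contf by (rule borel_measurable_continuous_onI)
    have f0: "f y = 0" if "\<rho> \<le> dist y x" for y
    proof -
      have "\<rho>\<^sup>2 \<le> (dist y x)\<^sup>2" using that \<rho> by (intro power_mono) auto
      then show ?thesis by (simp add: f_def inner_diff_eq_dist k(4))
    qed
    obtain B where B: "\<forall>y\<in>cball x \<rho>. \<bar>f y\<bar> \<le> B"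
      using continuous_bounded_on_cball[OF contf] by blast
    have fb: "\<bar>f y\<bar> \<le> \<bar>B\<bar>" for y
      using B f0[of y] by (cases "y \<in> cball x \<rho>") (force simp: dist_commute)+
    note fD = integral_bounded_times_defect[OF fm fb p(1), of r, folded D_def]
    let ?I = "\<lambda>y. indicator (ball x r) y :: real"
    have mean: "c * r\<^sup>2 * (b * (2 * e) powr (- b) * ?I y - 8 * real ?d * (\<rho>\<^sup>2) powr (- b)) \<le> f y - ball_mean r f y" for y
    proof (cases "y \<in> ball x r")
      case True
      have "ball_mean r f y \<le> f y + c * (8 * real ?d * (\<rho>\<^sup>2) powr (- b) - b * (2 * e) powr (- b)) * r\<^sup>2"
        unfolding f_def c_def
      proof (rule radial_ball_mean_le[OF k(1,2,3)])
        fix s :: real assume s: "0 \<le> s" "sqrt s \<le> dist y x + r"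
        then have "sqrt s \<le> 2 * r" using True by (simp add: dist_commute)
        then have "(sqrt s)\<^sup>2 \<le> (2 * r)\<^sup>2" using s by (intro power_mono) auto
        then have "s \<le> e" using s by (simp add: e_def power_mult_distrib)
        then show "4 * s * k2 s + 2 * real ?d * k1 s \<le> 8 * real ?d * (\<rho>\<^sup>2) powr (- b) - b * (2 * e) powr (- b)"
          using k(8) s by blast
      qed (use r in auto)
      then show ?thesis using True by (simp add: algebra_simps)
    next
      case False
      have "ball_mean r f y \<le> f y + c * (8 * real ?d * (\<rho>\<^sup>2) powr (- b)) * r\<^sup>2"
        unfolding f_def c_def
        by (rule radial_ball_mean_le[OF k(1,2,3)]) (use r k(7) in auto)
      then show ?thesis using False by (simp add: algebra_simps)
    qed
    have intI: "integrable lborel (\<lambda>y. ?I y * p y)"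
      using integrable_mult_indicator[of "ball x r" lborel p] p(1) by auto
    have powe: "(2 * e) powr (- b) = 8 powr (- b) / r ^ ?d"
    proof -
      have "(2 * e) powr (- b) = (8 * r\<^sup>2) powr (- b)" by (simp add: e_def)
      also have "\<dots> = 8 powr (- b) * (r\<^sup>2) powr (- b)" using r by (simp add: powr_mult)
      also have "(r\<^sup>2) powr (- b) = r powr (- real ?d)"
      proof -
        have sq: "r\<^sup>2 = r powr 2" using r by simp
        have "2 * - b = - real ?d" by (simp add: b_def)
        then show ?thesis unfolding sq by (simp only: powr_powr)
      qed
      also have "\<dots> = 1 / r ^ ?d" using r by (simp only: powr_minus_divide powr_realpow)
      finally show ?thesis by simp
    qed
    have "c * b * 8 powr (- b) * ((\<integral>y. ?I y * p y \<partial>lborel) / r ^ ?d) - c * (8 * real ?d * (\<rho>\<^sup>2) powr (- b)) * P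
        = 1 / r\<^sup>2 * (\<integral>y. c * r\<^sup>2 * (b * (2 * e) powr (- b)) * (?I y * p y) - c * r\<^sup>2 * (8 * real ?d * (\<rho>\<^sup>2) powr (- b)) * p y \<partial>lborel)"
    proof -
      have "(\<integral>y. \<alpha> * (?I y * p y) - \<beta> * p y \<partial>lborel) = \<alpha> * (\<integral>y. ?I y * p y \<partial>lborel) - \<beta> * P" for \<alpha> \<beta>
        using Bochner_Integration.integral_diff[OF integrable_mult_right[OF intI] integrable_mult_right[OF p(1)], of \<alpha> \<beta>]
        by (simp only: integral_mult_right_zero P_def)
      then show ?thesis
        using r by (simp only: powe) (simp add: field_simps)
    qed
    also have "\<dots> \<le> 1 / r\<^sup>2 * (\<integral>y. (f y - ball_mean r f y) * p y \<partial>lborel)"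
    proof (intro mult_left_mono Bochner_Integration.integral_mono fD(2))
      fix y
      from mult_right_mono[OF mean[of y] p(2)[of y]]
      show "c * r\<^sup>2 * (b * (2 * e) powr (- b)) * (?I y * p y) - c * r\<^sup>2 * (8 * real ?d * (\<rho>\<^sup>2) powr (- b)) * p y
          \<le> (f y - ball_mean r f y) * p y"
        by (simp add: algebra_simps)
    qed (use intI p(1) in auto)
    also have "\<dots> = (\<integral>y. 1 / r\<^sup>2 * (f y * D y) \<partial>lborel)"
      using fD(3) by simp
    also have "\<dots> \<le> w x"
      unfolding w(1)
    proof (rule Bochner_Integration.integral_mono_AE)
      show "integrable lborel (\<lambda>y. 1 / r\<^sup>2 * (f y * D y))"
        by (intro integrable_mult_right fD(1))
      show "AE y in lborel. 1 / r\<^sup>2 * (f y * D y) \<le> g y * \<kappa> ((y - x) \<bullet> (y - x))"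
        using AEg
      proof eventually_elim
        case (elim y)
        show ?case
        proof (cases "y \<in> ?B")
          case True
          have "dist y x \<le> 3 * \<rho>" using True x dist_triangle[of y x a] by (simp add: dist_commute)
          then have "(dist y x)\<^sup>2 \<le> (3 * \<rho>)\<^sup>2" by (intro power_mono) auto
          then have "(dist y x)\<^sup>2 \<le> S" using S by (simp add: power_mult_distrib)
          then have "f y \<le> \<kappa> ((y - x) \<bullet> (y - x))"
            unfolding f_def \<kappa>_def inner_diff_eq_dist by (intro k(6)) auto
          from mult_left_mono[OF this g0[of y]] show ?thesis
            using elim True by (simp add: mult_ac)
        next
          case False
          have "\<rho> \<le> dist y x" using False x dist_triangle[of y a x] by (simp add: dist_commute)
          then show ?thesis using False f0[of y] by (simp add: g_def)
        qed
      qed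
    qed (rule w(2))
    finally show ?thesis .
  qed
  show thesis
    by (rule that[OF contw subw near far[unfolded P_def] deep[unfolded P_def]])
qed

section \<open>Balayage of compactly supported measures\<close>

lemma Meas_cmp_space: "M \<in> Meas_cmp U \<Longrightarrow> space M = U"
  using sets_eq_imp_space_eq[of M "restrict_space borel U"]
  by (simp add: Meas_cmp_def space_restrict_space)

lemma Meas_cmp_measurable:
  assumes "M \<in> Meas_cmp U" "f \<in> borel_measurable borel"
  shows "f \<in> borel_measurable M"
proof -
  have "sets M = sets (restrict_space borel U)" using assms(1) by (simp add: Meas_cmp_def)
  then show ?thesis
    using measurable_restrict_space1[OF assms(2), of U] measurable_cong_sets[OF _ refl] by blast
qed

lemma Meas_cmp_sets:
  assumes "open U" "M \<in> Meas_cmp U"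
  shows "A \<in> sets M \<longleftrightarrow> A \<in> sets borel \<and> A \<subseteq> U"
  using assms sets_restrict_space_iff[of U borel A] by (auto simp: Meas_cmp_def)

text \<open>
  The complement of the support is covered by open null sets, of which countably many suffice.
\<close>

lemma AE_measure_support:
  fixes M :: "'a::euclidean_space measure"
  assumes U: "open U" and M: "M \<in> Meas_cmp U"
  shows "AE x in M. x \<in> measure_support M"
proof -
  note sp = Meas_cmp_space[OF M]
  define F where "F = {V. open V \<and> emeasure M (V \<inter> U) = 0}"
  obtain F' where F': "F' \<subseteq> F" "countable F'" "\<Union>F' = \<Union>F"
    using Lindelof[of F] by (auto simp: F_def)
  have "(\<Union>V\<in>F'. V \<inter> U) \<in> null_sets M"
  proof (rule null_sets_UN')
    fix V assume "V \<in> F'"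
    then have V: "open V" "emeasure M (V \<inter> U) = 0" using F' by (auto simp: F_def)
    have "V \<inter> U \<in> sets M" using V(1) U Meas_cmp_sets[OF U M] by auto
    then show "V \<inter> U \<in> null_sets M" using V(2) by auto
  qed (rule F'(2))
  then have "AE x in M. x \<notin> (\<Union>V\<in>F'. V \<inter> U)" by (rule AE_not_in)
  then show ?thesis
  proof (rule AE_mp, intro AE_I2 impI)
    fix x assume x: "x \<in> space M" "x \<notin> (\<Union>V\<in>F'. V \<inter> U)"
    then have "x \<notin> \<Union>F" using sp F'(3) by auto
    then show "x \<in> measure_support M"
      using x sp by (auto simp: measure_support_def F_def zero_less_iff_neq_zero)
  qed
qed

lemma Meas_cmp_finite:
  fixes M :: "'a::euclidean_space measure"
  assumes U: "open U" and M: "M \<in> Meas_cmp U"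
  shows "emeasure M U < \<infinity>"
proof -
  note sp = Meas_cmp_space[OF M]
  have c: "compact (measure_support M)" using M by (simp add: Meas_cmp_def)
  have sub: "measure_support M \<subseteq> U" using sp by (auto simp: measure_support_def)
  have "measure_support M \<in> sets M"
    using Meas_cmp_sets[OF U M] c sub by (auto intro: borel_compact)
  then have "emeasure M U = emeasure M (measure_support M)"
    using AE_measure_support[OF U M] sp U Meas_cmp_sets[OF U M] sub
    by (intro emeasure_eq_AE) auto
  also have "\<dots> < \<infinity>" using M c sub by (simp add: Meas_cmp_def)
  finally show ?thesis .
qed

text \<open>
  Testing the balayage with \<open>- w\<close>. Positivity of \<open>w\<close> with respect to \<open>\<omega>\<close> makes the integral over
  \<open>\<omega>\<close> purely negative; with respect to \<open>\<delta>\<close> the positive part of \<open>- w\<close> can be discarded.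
\<close>

lemma balayage_nn_integral_le:
  fixes w :: "'a::euclidean_space \<Rightarrow> real"
  assumes bal: "sbh_balayage U \<delta> \<omega>" and sub: "subharmonic_on U (\<lambda>x. ereal (- w x))"
    and pos: "AE x in \<omega>. 0 \<le> w x"
  shows "(\<integral>\<^sup>+x. ennreal (w x) \<partial>\<omega>) \<le> (\<integral>\<^sup>+x. ennreal (w x) \<partial>\<delta>)"
proof -
  have "(\<integral>\<^sup>+x. ennreal (- w x) \<partial>\<omega>) = (\<integral>\<^sup>+x. 0 \<partial>\<omega>)"
    using pos by (intro nn_integral_cong_AE) (auto simp: ennreal_neg)
  then have z: "(\<integral>\<^sup>+x. ennreal (- w x) \<partial>\<omega>) = 0" by simp
  have "ereal_integral \<delta> (\<lambda>x. ereal (- w x)) \<le> ereal_integral \<omega> (\<lambda>x. ereal (- w x))"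
    using bal sub by (simp add: sbh_balayage_def)
  then have "enn2ereal (\<integral>\<^sup>+x. ennreal (- w x) \<partial>\<delta>) - enn2ereal (\<integral>\<^sup>+x. ennreal (w x) \<partial>\<delta>)
      \<le> - enn2ereal (\<integral>\<^sup>+x. ennreal (w x) \<partial>\<omega>)"
    by (simp add: ereal_integral_def z zero_ennreal.rep_eq)
  moreover have "- enn2ereal (\<integral>\<^sup>+x. ennreal (w x) \<partial>\<delta>)
      \<le> enn2ereal (\<integral>\<^sup>+x. ennreal (- w x) \<partial>\<delta>) - enn2ereal (\<integral>\<^sup>+x. ennreal (w x) \<partial>\<delta>)"
  proof -
    have "0 + - enn2ereal (\<integral>\<^sup>+x. ennreal (w x) \<partial>\<delta>)
      \<le> enn2ereal (\<integral>\<^sup>+x. ennreal (- w x) \<partial>\<delta>) + - enn2ereal (\<integral>\<^sup>+x. ennreal (w x) \<partial>\<delta>)"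
      by (intro add_right_mono) simp
    then show ?thesis by (simp add: minus_ereal_def)
  qed
  ultimately have "- enn2ereal (\<integral>\<^sup>+x. ennreal (w x) \<partial>\<delta>) \<le> - enn2ereal (\<integral>\<^sup>+x. ennreal (w x) \<partial>\<omega>)"
    by (rule order_trans[rotated])
  then show ?thesis by (simp add: less_eq_ennreal.rep_eq)
qed

text \<open>
  The potentials \<open>w n\<close> belonging to radii \<open>r n\<close> that tend to zero are nonnegative on the support of \<open>\<omega>\<close> and
  uniformly bounded above on the support of \<open>\<delta>\<close>, so balayage bounds their \<open>\<omega>\<close>-integrals. They
  tend to infinity at every singularity of \<open>u\<close> near \<open>a\<close>; by Fatou's lemma these singularities form an
  \<open>\<omega>\<close>-null set.
\<close>

lemma balayage_null_near_point:
  fixes u :: "'a::euclidean_space \<Rightarrow> ereal"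
  assumes U: "open U" and \<delta>: "\<delta> \<in> Meas_cmp U" and \<omega>: "\<omega> \<in> Meas_cmp U"
    and bal: "sbh_balayage U \<delta> \<omega>"
    and u: "subharmonic_on UNIV u" and x0: "u x0 \<noteq> - \<infinity>"
    and a: "a \<notin> measure_support \<delta>"
  shows "\<exists>\<rho>>0. AE x in \<omega>. x \<in> cball a \<rho> \<longrightarrow> u x \<noteq> - \<infinity>"
proof -
  have "closed (measure_support \<delta>)" using \<delta> by (auto simp: Meas_cmp_def intro: compact_imp_closed)
  then obtain \<epsilon> where \<epsilon>: "0 < \<epsilon>" "ball a \<epsilon> \<subseteq> - measure_support \<delta>"
    using a by (metis closed_def open_contains_ball ComplI)
  define \<rho> where "\<rho> = \<epsilon> / 3"
  have \<rho>: "0 < \<rho>" "ball a (3 * \<rho>) \<inter> measure_support \<delta> = {}" using \<epsilon> by (simp_all add: \<rho>_def disjoint_eq_subset_Compl)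
  have R: "0 < 4 * \<rho>" using \<rho> by simp
  obtain p where p: "integrable lborel p" "\<And>y. 0 \<le> p y"
    "\<And>r. 0 < r \<Longrightarrow> AE y in lborel. cball y r \<subseteq> cball a (4 * \<rho>) \<longrightarrow> ball_mean r p y \<le> p y"
    "\<And>x M. \<lbrakk>x \<in> ball a (4 * \<rho>); u x = - \<infinity>\<rbrakk> \<Longrightarrow> \<exists>\<eta>>0. AE y in lborel. y \<in> ball x \<eta> \<longrightarrow> M \<le> p y"
    by (rule polar_function_density[OF u x0 R, of a]) (rule that)
  have "bounded (measure_support \<omega>)" using \<omega> by (auto simp: Meas_cmp_def intro: compact_imp_bounded)
  then obtain D where D: "\<And>x. x \<in> measure_support \<omega> \<Longrightarrow> dist a x \<le> D"
    using bounded_any_center[of "measure_support \<omega>" a] by blast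
  \<comment> \<open>The kernel \<open>K S - K s\<close> is nonnegative for \<open>s \<le> S\<close>; this range has to contain all squared distances
    between the support of \<open>\<omega>\<close> and the ball that carries the mass.\<close>
  define S where "S = max (9 * \<rho>\<^sup>2) ((D + 2 * \<rho>)\<^sup>2)"
  have S: "9 * \<rho>\<^sup>2 \<le> S" by (simp add: S_def)
  have S_dist: "(dist x y)\<^sup>2 \<le> S" if "x \<in> measure_support \<omega>" "y \<in> ball a (2 * \<rho>)" for x y
  proof -
    have "dist x y \<le> D + 2 * \<rho>"
      using D[OF that(1)] that(2) dist_triangle[of x y a] by (simp add: dist_commute)
    then have "(dist x y)\<^sup>2 \<le> (D + 2 * \<rho>)\<^sup>2" by (intro power_mono) auto
    then show ?thesis by (simp add: S_def)
  qed
  define b where "b = real DIM('a) / 2"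
  define c where "c = ball_mean_constant TYPE('a)"
  have c: "0 < c" unfolding c_def by (rule ball_mean_constant_pos)
  have b: "0 < b" by (simp add: b_def)
  define C0 where "C0 = S * (\<rho>\<^sup>2) powr (- b) * (8 * c * (6 * real DIM('a) / (9 * \<rho>\<^sup>2)) * (\<integral>y. p y \<partial>lborel))"
  define C1 where "C1 = c * (8 * real DIM('a) * (\<rho>\<^sup>2) powr (- b)) * (\<integral>y. p y \<partial>lborel)"
  define r where "r n = \<rho> / (real n + 4)" for n
  have r: "0 < r n" "r n \<le> \<rho> / 4" for n
  proof -
    show "0 < r n" using \<rho>(1) by (simp add: r_def)
    show "r n \<le> \<rho> / 4" unfolding r_def using \<rho>(1) by (intro divide_left_mono) auto
  qed
  have r_lim: "r \<longlonglongrightarrow> 0"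
    unfolding r_def by real_asymp
  define good where "good n w \<longleftrightarrow> continuous_on UNIV w \<and> subharmonic_on U (\<lambda>x. ereal (- w x)) \<and>
      (\<forall>x\<in>measure_support \<omega>. 0 \<le> w x) \<and> (\<forall>x\<in>measure_support \<delta>. w x \<le> C0) \<and>
      (\<forall>x\<in>cball a \<rho>. c * b * 8 powr (- b) * ((\<integral>y. indicator (ball x (r n)) y * p y \<partial>lborel) / r n ^ DIM('a)) - C1 \<le> w x)"
    for n and w :: "'a \<Rightarrow> real"
  have "\<exists>w. good n w" for n
  proof (rule swept_potential[OF \<rho>(1) p(1,2) r p(3)[OF r(1)] S, of n, folded b_def c_def, folded C0_def C1_def])
    fix w
    assume w: "continuous_on UNIV w" "\<And>U. subharmonic_on U (\<lambda>x. ereal (- w x))"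
      "\<And>x. (\<And>y. y \<in> ball a (2 * \<rho>) \<Longrightarrow> (dist x y)\<^sup>2 \<le> S) \<Longrightarrow> 0 \<le> w x"
      "\<And>x. x \<notin> ball a (3 * \<rho>) \<Longrightarrow> w x \<le> C0"
      "\<And>x. x \<in> cball a \<rho> \<Longrightarrow> c * b * 8 powr (- b) * ((\<integral>y. indicator (ball x (r n)) y * p y \<partial>lborel) / r n ^ DIM('a)) - C1 \<le> w x"
    show ?thesis
      unfolding good_def
    proof (intro exI conjI ballI)
      show "0 \<le> w x" if "x \<in> measure_support \<omega>" for x
        by (rule w(3)) (rule S_dist[OF that])
      show "w x \<le> C0" if "x \<in> measure_support \<delta>" for x
        using w(4)[of x] \<rho>(2) that by blast
    qed (use w(1,2,5) in auto)
  qed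
  then obtain w where good: "\<And>n. good n (w n)"
    by metis
  have w: "\<And>n. continuous_on UNIV (w n)" "\<And>n. subharmonic_on U (\<lambda>x. ereal (- w n x))"
      "\<And>n x. x \<in> measure_support \<omega> \<Longrightarrow> 0 \<le> w n x" "\<And>n x. x \<in> measure_support \<delta> \<Longrightarrow> w n x \<le> C0"
      "\<And>n x. x \<in> cball a \<rho> \<Longrightarrow>
        c * b * 8 powr (- b) * ((\<integral>y. indicator (ball x (r n)) y * p y \<partial>lborel) / r n ^ DIM('a)) - C1 \<le> w n x"
    using good unfolding good_def by blast+
  have wm[measurable]: "(\<lambda>x. ennreal (w n x)) \<in> borel_measurable \<omega>" for n
    using Meas_cmp_measurable[OF \<omega> borel_measurable_continuous_onI[OF w(1)[of n]]] by measurable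
  have mass: "(\<integral>\<^sup>+x. ennreal (w n x) \<partial>\<omega>) \<le> ennreal C0 * emeasure \<delta> U" for n
  proof -
    have "(\<integral>\<^sup>+x. ennreal (w n x) \<partial>\<omega>) \<le> (\<integral>\<^sup>+x. ennreal (w n x) \<partial>\<delta>)"
      using AE_measure_support[OF U \<omega>]
      by (intro balayage_nn_integral_le[OF bal w(2)]) (auto elim!: eventually_mono intro: w(3))
    also have "\<dots> \<le> (\<integral>\<^sup>+x. ennreal C0 \<partial>\<delta>)"
      using AE_measure_support[OF U \<delta>]
      by (intro nn_integral_mono_AE) (auto elim!: eventually_mono intro!: ennreal_leI w(4))
    also have "\<dots> = ennreal C0 * emeasure \<delta> U" by (simp add: Meas_cmp_space[OF \<delta>])
    finally show ?thesis .
  qed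
  have "(\<integral>\<^sup>+x. liminf (\<lambda>n. ennreal (w n x)) \<partial>\<omega>) \<le> liminf (\<lambda>n. \<integral>\<^sup>+x. ennreal (w n x) \<partial>\<omega>)"
    by (rule nn_integral_liminf) measurable
  also have "\<dots> \<le> limsup (\<lambda>n. \<integral>\<^sup>+x. ennreal (w n x) \<partial>\<omega>)"
    by (rule Liminf_le_Limsup) simp
  also have "\<dots> \<le> ennreal C0 * emeasure \<delta> U"
    using mass by (intro Limsup_bounded always_eventually) auto
  also have "\<dots> < \<infinity>" using Meas_cmp_finite[OF U \<delta>] by (simp add: ennreal_mult_less_top)
  finally have "AE x in \<omega>. liminf (\<lambda>n. ennreal (w n x)) \<noteq> \<infinity>"
    by (intro nn_integral_noteq_infinite) auto
  moreover have "liminf (\<lambda>n. ennreal (w n x)) = \<infinity>" if x: "x \<in> cball a \<rho>" "u x = - \<infinity>" for x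
  proof -
    define V where "V = measure lborel (cball (0::'a) 1)"
    have V: "0 < V" unfolding V_def by (rule unit_ball_volume_pos)
    \<comment> \<open>\<open>A M\<close> is the lower bound, up to the error \<open>C1\<close>, that results from \<open>p \<ge> M\<close> on \<open>ball x (r n)\<close>.\<close>
  define A where "A = c * b * 8 powr (- b) * V"
    have A: "0 < A" using c b V by (simp add: A_def)
    have large: "of_nat N \<le> liminf (\<lambda>n. ennreal (w n x))" for N :: nat
    proof (rule Liminf_bounded)
      define M where "M = (real N + C1) / A"
      have "x \<in> ball a (4 * \<rho>)" using x \<rho> by simp
      from p(4)[OF this x(2), of M] obtain \<eta> where
        \<eta>: "0 < \<eta>" "AE y in lborel. y \<in> ball x \<eta> \<longrightarrow> M \<le> p y" by blast
      have "\<forall>\<^sub>F n in sequentially. r n < \<eta>" using order_tendstoD(2)[OF r_lim \<eta>(1)] .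
      then show "\<forall>\<^sub>F n in sequentially. of_nat N \<le> ennreal (w n x)"
      proof eventually_elim
        case (elim n)
        have vol: "measure lborel (ball x (r n)) = V * r n ^ DIM('a)"
          using r(1)[of n] measure_cball_scaled[of "r n" x] by (simp add: V_def content_cball_conv_ball)
        have int1: "integrable lborel (\<lambda>y. M * indicator (ball x (r n)) y)"
          using emeasure_lborel_ball_finite[of x "r n"] by auto
        have int2: "integrable lborel (\<lambda>y. indicator (ball x (r n)) y * p y)"
          using integrable_mult_indicator[of "ball x (r n)" lborel p] p(1) by auto
        have "M * (V * r n ^ DIM('a)) = (\<integral>y. M * indicator (ball x (r n)) y \<partial>lborel)"
          using vol by simp
        also have "\<dots> \<le> (\<integral>y. indicator (ball x (r n)) y * p y \<partial>lborel)"
        proof (rule Bochner_Integration.integral_mono_AE[OF int1 int2])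
          show "AE y in lborel. M * indicator (ball x (r n)) y \<le> indicator (ball x (r n)) y * p y"
            using \<eta>(2) by eventually_elim (use elim in \<open>auto simp: indicator_def\<close>)
        qed
        finally have "M * V \<le> (\<integral>y. indicator (ball x (r n)) y * p y \<partial>lborel) / r n ^ DIM('a)"
          using r(1)[of n] by (simp add: field_simps)
        then have "c * b * 8 powr (- b) * (M * V)
            \<le> c * b * 8 powr (- b) * ((\<integral>y. indicator (ball x (r n)) y * p y \<partial>lborel) / r n ^ DIM('a))"
          using c b by (intro mult_left_mono) auto
        then have "c * b * 8 powr (- b) * (M * V) - C1 \<le> w n x"
          using w(5)[OF x(1), of n] by linarith
        moreover have "c * b * 8 powr (- b) * (M * V) = M * A" by (simp add: A_def)
        moreover have "M * A = real N + C1" using A by (simp add: M_def)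
        ultimately have "real N \<le> w n x" by simp
        from ennreal_leI[OF this] show ?case by (simp add: ennreal_of_nat_eq_real_of_nat)
      qed
    qed
    show ?thesis
    proof (rule ccontr)
      assume "liminf (\<lambda>n. ennreal (w n x)) \<noteq> \<infinity>"
      then obtain N :: nat where "liminf (\<lambda>n. ennreal (w n x)) < of_nat N"
        using ennreal_Ex_less_of_nat[of "liminf (\<lambda>n. ennreal (w n x))"] by (auto simp: less_top)
      with large[of N] show False by simp
    qed
  qed
  ultimately have "AE x in \<omega>. x \<in> cball a \<rho> \<longrightarrow> u x \<noteq> - \<infinity>"
    by (auto elim!: eventually_mono)
  then show ?thesis using \<rho>(1) by blast
qed

theorem theorem3:
  fixes U E :: "'a::euclidean_space set" and \<delta> \<omega> :: "'a measure"
  assumes "open U" and "U \<noteq> {}"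
    and "\<delta> \<in> Meas_cmp U" and "\<omega> \<in> Meas_cmp U"
    and "sbh_balayage U \<delta> \<omega>"
    and "polar E"
  shows "outer_measure_of \<omega> ((U \<inter> E) - measure_support \<delta>) = 0"
proof -
  obtain u x0 where u: "subharmonic_on UNIV u" "u x0 \<noteq> - \<infinity>" "E \<subseteq> {x. u x = - \<infinity>}"
    using \<open>polar E\<close> by (auto simp: polar_def)
  have "\<forall>a\<in>- measure_support \<delta>. \<exists>\<rho>>0. AE x in \<omega>. x \<in> cball a \<rho> \<longrightarrow> u x \<noteq> - \<infinity>"
    using balayage_null_near_point[OF assms(1,3,4,5) u(1,2)] by blast
  then obtain \<rho> where \<rho>: "\<And>a. a \<notin> measure_support \<delta> \<Longrightarrow> 0 < \<rho> a"
    "\<And>a. a \<notin> measure_support \<delta> \<Longrightarrow> AE x in \<omega>. x \<in> cball a (\<rho> a) \<longrightarrow> u x \<noteq> - \<infinity>"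
    by (metis ComplI)
  obtain F where F: "F \<subseteq> (\<lambda>a. ball a (\<rho> a)) ` (- measure_support \<delta>)" "countable F"
    "\<Union>F = \<Union>((\<lambda>a. ball a (\<rho> a)) ` (- measure_support \<delta>))"
    using Lindelof[of "(\<lambda>a. ball a (\<rho> a)) ` (- measure_support \<delta>)"] by auto
  have "AE x in \<omega>. \<forall>B\<in>F. x \<in> B \<longrightarrow> u x \<noteq> - \<infinity>"
  proof (subst AE_ball_countable[OF F(2)], intro ballI)
    fix B assume "B \<in> F"
    then obtain a where a: "a \<notin> measure_support \<delta>" "B = ball a (\<rho> a)" using F(1) by auto
    show "AE x in \<omega>. x \<in> B \<longrightarrow> u x \<noteq> - \<infinity>"
      using \<rho>(2)[OF a(1)] by eventually_elim (use a(2) in auto)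
  qed
  then have "AE x in \<omega>. x \<notin> measure_support \<delta> \<longrightarrow> u x \<noteq> - \<infinity>"
  proof eventually_elim
    case (elim x)
    show ?case
    proof
      assume x: "x \<notin> measure_support \<delta>"
      then have "x \<in> ball x (\<rho> x)" using \<rho>(1) by simp
      then have "x \<in> \<Union>F" unfolding F(3) using x by blast
      then show "u x \<noteq> - \<infinity>" using elim by blast
    qed
  qed
  moreover define Q where "Q = {x \<in> U. u x = - \<infinity>} - measure_support \<delta>"
  ultimately have AEQ: "AE x in \<omega>. x \<notin> Q" by (auto elim!: eventually_mono)
  have "Q = (U \<inter> u -` {- \<infinity>}) - measure_support \<delta>" by (auto simp: Q_def)
  moreover have "u -` {- \<infinity>} \<in> sets borel"
    using measurable_sets[OF subharmonic_measurable[OF u(1)], of "{- \<infinity>}"] by simp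
  moreover have "measure_support \<delta> \<in> sets borel"
    using assms(3) by (auto simp: Meas_cmp_def intro: borel_compact)
  ultimately have Qs: "Q \<in> sets \<omega>"
    using assms(1) Meas_cmp_sets[OF assms(1,4)] by auto
  have "outer_measure_of \<omega> ((U \<inter> E) - measure_support \<delta>) \<le> outer_measure_of \<omega> Q"
    using u(3) by (intro outer_measure_of_mono) (auto simp: Q_def)
  also have "\<dots> = emeasure \<omega> Q" by (rule outer_measure_of_eq[OF Qs])
  also have "\<dots> = 0"
    using AEQ Qs AE_iff_measurable[OF Qs, of "\<lambda>x. x \<notin> Q"] sets.sets_into_space[OF Qs] by auto
  finally show ?thesis by simp
qed

end
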